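(* Let $M$ be a smooth manifold of dimension $m\ge 2$ and let $(M,\bar F)$ be a pseudo-Finsler space, where $\bar F$ is positively homogeneous of degree $n\ge2$ in $(\dot x_i)$. Let $\mathscr F$ be the isotropic hypersurface, given by $\bar F(x_i;\dot x_i)=0$ in $TM$ or, equivalently, by $F(x,y_i,p_i)=0$ in $PTM$. Then $\mathscr F$ is an invariant hypersurface of both the Euler–Lagrange system $$\sum_{j=1}^{m}\frac{\partial^2\bar F}{\partial\dot x_i\partial\dot x_j}\ddot x_j+\sum_{j=1}^m\frac{\partial^2\bar F}{\partial\dot x_i\partial x_j}\dot x_j=\frac{\partial\bar F}{\partial x_i},\qquad i=1,\dots,m,$$ of the functional $J^{(n)}(\gamma)=\int_I\bar F(x_i;\dot x_i)\,dt$ and its projectivization $$p_i=\frac{dy_i}{dx},\qquad \frac{dp_i}{dx}=\frac{H_i-p_iH_1}{H},\qquad i=2,\dots,m.$$ Moreover, in the case $m=2$ all isotropic lines are non-parametrized extremals of the functional $J^{(n)}$.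
   Context: Smooth means $C^\infty$. $\bar F(x_i;\dot x_i):TM\to\mathbb R$ is positively homogeneous of degree $n$ in $(\dot x_i)$ and smooth on the complement of the zero section; no positivity of $\bar F$ and no convexity condition is assumed (pseudo-Finsler space with metric function $\bar F^{1/n}$). $PTM$ is the projectivized tangent bundle with coordinates $x=x_1$, $y_i=x_i$, $p_i=dy_i/dx=\dot x_i/\dot x_1$ for $i=2,\dots,m$. For a function $\bar\Phi$ on $TM$ positively homogeneous of degree $k$ in $(\dot x_i)$ put $\Phi=\bar\Phi/\dot x_1^k$, viewed as a function of $(x,y_i,p_i)$, i.e. $\Phi$ is the value of $\bar\Phi$ at $\dot x_1=1$, $\dot x_i=p_i$. Let $\bar H=\det\bigl(\partial^2\bar F/\partial\dot x_i\partial\dot x_j\bigr)$, and let $\bar H_i$ be the determinants given by Cramer's rule when the Euler–Lagrange system is solved for $\ddot x_i$, so that $\ddot x_i=\bar H_i/\bar H$; that is, $\bar H_i$ is obtained from $\bar H$ by replacing the $i$-th column with the column of entries $\frac{\partial\bar F}{\partial x_k}-\sum_j\frac{\partial^2\bar F}{\partial\dot x_k\partial x_j}\dot x_j$, $k=1,\dots,m$. $H,H_i$ are obtained from $\bar H,\bar H_i$ (of degrees $m(n-2)$ and $m(n-2)+2$, respectively) by the rule above. The projectivized equation is understood on the whole $PTM$ as the vector field $H\bigl(\partial_x+\sum_i p_i\partial_{y_i}\bigr)+\sum_i(H_i-p_iH_1)\partial_{p_i}$, equivalently $dy_i=p_i\,dx$, $H\,dp_i=(H_i-p_iH_1)\,dx$.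 A hypersurface is invariant for a vector field if the field is tangent to it; for the Euler–Lagrange system, invariance means that a solution with $(x_i;\dot x_i)\in\mathscr F$ at one instant stays in $\mathscr F$. Isotropic lines are curves in $M$ along which $\bar F(x_i;\dot x_i)=0$. Non-parametrized extremals of $J^{(n)}$ are the projections to $M$ (distinct from a point) of integral curves of the projectivized equation in $PTM$. *)

theory Defs
  imports "HOL-Analysis.Analysis"
begin

section \<open>Smooth maps and smooth manifolds\<close>

text \<open>\<open>Ck_on k f S\<close> is the class \<open>C^k\<close> on \<open>S\<close>; it is meant for open \<open>S\<close> only.\<close>

fun Ck_on :: "nat \<Rightarrow> ('a::real_normed_vector \<Rightarrow> 'b::real_normed_vector) \<Rightarrow> 'a set \<Rightarrow> bool" where
  "Ck_on 0 f S \<longleftrightarrow> continuous_on S f"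
| "Ck_on (Suc k) f S \<longleftrightarrow>
     (\<forall>x\<in>S. f differentiable (at x)) \<and>
     (\<forall>v. Ck_on k (\<lambda>x. frechet_derivative f (at x) v) S)"

definition smooth_on :: "('a::real_normed_vector \<Rightarrow> 'b::real_normed_vector) \<Rightarrow> 'a set \<Rightarrow> bool" where
  "smooth_on f S \<longleftrightarrow> (\<forall>k. Ck_on k f S)"

text \<open>The manifold is a whole type \<open>'a\<close> with a maximal smooth atlas, of dimension \<open>CARD('m)\<close>.
  Hausdorffness and second countability are required through type classes where the manifold is
  introduced. A chart is its domain together with its coordinate map.\<close>

type_synonym ('a, 'm) chart = "'a set \<times> ('a \<Rightarrow> real ^ 'm)"

definition chart_inv :: "('a, 'm::finite) chart \<Rightarrow> real ^ 'm \<Rightarrow> 'a" where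
  "chart_inv c = inv_into (fst c) (snd c)"

definition is_chart :: "('a::topological_space, 'm::finite) chart \<Rightarrow> bool" where
  "is_chart c \<longleftrightarrow>
     open (fst c) \<and> open (snd c ` fst c) \<and>
     homeomorphism (fst c) (snd c ` fst c) (snd c) (chart_inv c)"

definition compatible :: "('a, 'm::finite) chart \<Rightarrow> ('a, 'm) chart \<Rightarrow> bool" where
  "compatible c d \<longleftrightarrow>
     smooth_on (snd d \<circ> chart_inv c) (snd c ` (fst c \<inter> fst d)) \<and>
     smooth_on (snd c \<circ> chart_inv d) (snd d ` (fst c \<inter> fst d))"

definition smooth_manifold :: "('a::topological_space, 'm::finite) chart set \<Rightarrow> bool" where
  "smooth_manifold A \<longleftrightarrow>
     (\<forall>c\<in>A. is_chart c) \<and> (\<Union>c\<in>A. fst c) = UNIV \<and>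
     (\<forall>c\<in>A. \<forall>d\<in>A. compatible c d) \<and>
     (\<forall>c. is_chart c \<and> (\<forall>d\<in>A. compatible c d) \<longrightarrow> c \<in> A)"


section \<open>Tangent bundle\<close>

text \<open>A tangent vector at \<open>p\<close> is the family of its component vectors in all charts around \<open>p\<close>,
  subject to the contravariant transformation law (and \<open>0\<close> at irrelevant indices, so that equality
  of tangent vectors is equality of functions). Points of \<open>TM\<close> are pairs \<open>(p, v)\<close> with
  \<open>v \<in> tangent_space A p\<close>.\<close>

type_synonym ('a, 'm) tvec = "('a, 'm) chart \<Rightarrow> real ^ 'm"

definition tangent_space :: "('a, 'm::finite) chart set \<Rightarrow> 'a \<Rightarrow> ('a, 'm) tvec set" where
  "tangent_space A p = {v.
     (\<forall>c\<in>A. \<forall>d\<in>A. p \<in> fst c \<inter> fst d \<longrightarrow>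
        v d = frechet_derivative (snd d \<circ> chart_inv c) (at (snd c p)) (v c)) \<and>
     (\<forall>c. c \<notin> A \<or> p \<notin> fst c \<longrightarrow> v c = 0)}"

text \<open>The tangent vector at \<open>p\<close> with components \<open>u\<close> in the chart \<open>c\<close>.\<close>

definition tvec_of ::
    "('a, 'm::finite) chart set \<Rightarrow> ('a, 'm) chart \<Rightarrow> 'a \<Rightarrow> real ^ 'm \<Rightarrow> ('a, 'm) tvec" where
  "tvec_of A c p u = (\<lambda>d. if d \<in> A \<and> p \<in> fst d
     then frechet_derivative (snd d \<circ> chart_inv c) (at (snd c p)) u else 0)"

definition velocity ::
    "('a, 'm::finite) chart set \<Rightarrow> (real \<Rightarrow> 'a) \<Rightarrow> real \<Rightarrow> ('a, 'm) tvec" where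
  "velocity A \<gamma> t = (\<lambda>c. if c \<in> A \<and> \<gamma> t \<in> fst c
     then vector_derivative (snd c \<circ> \<gamma>) (at t) else 0)"

text \<open>A function on \<open>TM\<close> in the local coordinates \<open>(x; xdot)\<close> induced by the chart \<open>c\<close>.\<close>

definition loc ::
    "('a, 'm::finite) chart set \<Rightarrow> ('a, 'm) chart \<Rightarrow> ('a \<Rightarrow> ('a, 'm) tvec \<Rightarrow> real)
     \<Rightarrow> (real ^ 'm) \<times> (real ^ 'm) \<Rightarrow> real" where
  "loc A c F z = F (chart_inv c (fst z)) (tvec_of A c (chart_inv c (fst z)) (snd z))"

definition pseudo_finsler ::
    "('a, 'm::finite) chart set \<Rightarrow> real \<Rightarrow> ('a \<Rightarrow> ('a, 'm) tvec \<Rightarrow> real) \<Rightarrow> bool" where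
  "pseudo_finsler A n F \<longleftrightarrow>
     (\<forall>p. \<forall>v\<in>tangent_space A p. \<forall>r>0. F p (\<lambda>c. r *\<^sub>R v c) = r powr n * F p v) \<and>
     (\<forall>c\<in>A. smooth_on (loc A c F) ((snd c ` fst c) \<times> (UNIV - {0})))"


section \<open>Euler--Lagrange system in local coordinates\<close>

definition pd_x :: "'m \<Rightarrow> ((real ^ 'm::finite) \<times> (real ^ 'm) \<Rightarrow> real) \<Rightarrow> (real ^ 'm) \<times> (real ^ 'm) \<Rightarrow> real"
  where "pd_x i G z = frechet_derivative G (at z) (axis i 1, 0)"

definition pd_v :: "'m \<Rightarrow> ((real ^ 'm::finite) \<times> (real ^ 'm) \<Rightarrow> real) \<Rightarrow> (real ^ 'm) \<times> (real ^ 'm) \<Rightarrow> real"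
  where "pd_v i G z = frechet_derivative G (at z) (0, axis i 1)"

definition hess_v :: "((real ^ 'm::finite) \<times> (real ^ 'm) \<Rightarrow> real) \<Rightarrow> (real ^ 'm) \<times> (real ^ 'm) \<Rightarrow> real ^ 'm ^ 'm"
  where "hess_v G z = (\<chi> i j. pd_v i (pd_v j G) z)"

definition EL_equation ::
    "((real ^ 'm::finite) \<times> (real ^ 'm) \<Rightarrow> real) \<Rightarrow> real ^ 'm \<Rightarrow> real ^ 'm \<Rightarrow> real ^ 'm \<Rightarrow> bool" where
  "EL_equation G x xd xdd \<longleftrightarrow>
     (\<forall>i. (\<Sum>j\<in>UNIV. pd_v i (pd_v j G) (x, xd) * xdd $ j)
        + (\<Sum>j\<in>UNIV. pd_v i (pd_x j G) (x, xd) * xd $ j) = pd_x i G (x, xd))"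

definition open_interval :: "real set \<Rightarrow> bool" where
  "open_interval I \<longleftrightarrow> open I \<and> is_interval I \<and> I \<noteq> {}"

definition regular_curve ::
    "('a::topological_space, 'm::finite) chart set \<Rightarrow> real set \<Rightarrow> (real \<Rightarrow> 'a) \<Rightarrow> bool" where
  "regular_curve A I \<gamma> \<longleftrightarrow>
     open_interval I \<and> continuous_on I \<gamma> \<and>
     (\<forall>t\<in>I. \<forall>c\<in>A. \<gamma> t \<in> fst c \<longrightarrow>
        (snd c \<circ> \<gamma>) differentiable (at t) \<and>
        (\<lambda>s. vector_derivative (snd c \<circ> \<gamma>) (at s)) differentiable (at t) \<and>
        vector_derivative (snd c \<circ> \<gamma>) (at t) \<noteq> 0)"

text \<open>Solutions live off the zero section (a regular curve has nonzero velocity), since the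
  second derivatives of \<open>F\<close> need not exist on it.\<close>

definition EL_solution ::
    "('a::topological_space, 'm::finite) chart set \<Rightarrow> ('a \<Rightarrow> ('a, 'm) tvec \<Rightarrow> real)
     \<Rightarrow> real set \<Rightarrow> (real \<Rightarrow> 'a) \<Rightarrow> bool" where
  "EL_solution A F I \<gamma> \<longleftrightarrow>
     regular_curve A I \<gamma> \<and>
     (\<forall>t\<in>I. \<forall>c\<in>A. \<gamma> t \<in> fst c \<longrightarrow>
        EL_equation (loc A c F) (snd c (\<gamma> t))
          (vector_derivative (snd c \<circ> \<gamma>) (at t))
          (vector_derivative (\<lambda>s. vector_derivative (snd c \<circ> \<gamma>) (at s)) (at t)))"

definition EL_invariant ::
    "('a::topological_space, 'm::finite) chart set \<Rightarrow> ('a \<Rightarrow> ('a, 'm) tvec \<Rightarrow> real)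
     \<Rightarrow> ('a \<times> ('a, 'm) tvec) set \<Rightarrow> bool" where
  "EL_invariant A F S \<longleftrightarrow>
     (\<forall>I \<gamma>. EL_solution A F I \<gamma> \<longrightarrow>
        (\<exists>t\<in>I. (\<gamma> t, velocity A \<gamma> t) \<in> S) \<longrightarrow> (\<forall>t\<in>I. (\<gamma> t, velocity A \<gamma> t) \<in> S))"


section \<open>Projectivization\<close>

text \<open>Since functions on \<open>TM\<close> are only positively homogeneous, projectivization identifies
  \<open>v\<close> with \<open>r v\<close> for \<open>r > 0\<close>: for functions without parity in \<open>v\<close>, the value at
  \<open>xdot_k = 1\<close> carries no information about vectors with \<open>xdot_k < 0\<close>.

  A chart \<open>c\<close> and an index \<open>k\<close> (the coordinate playing the role of the independent variable)
  give an affine chart of \<open>PTM\<close> on \<open>xdot_k > 0\<close>, with coordinates \<open>(x, p)\<close>, \<open>p_i = xdot_i / xdot_k\<close>.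
  The vector \<open>p\<close> keeps the redundant component \<open>p_k = 1\<close>, so that the function \<open>\<Phi>\<close> obtained from
  \<open>\<Phi>bar\<close> by putting \<open>xdot_k = 1\<close>, \<open>xdot_i = p_i\<close> is \<open>\<Phi>bar (x, p)\<close> on the slice \<open>p_k = 1\<close>. These
  affine charts cover \<open>PTM\<close>, because a maximal atlas contains, with any chart, the one obtained by
  changing the sign of a coordinate.\<close>

definition ptm_coords ::
    "('a, 'm::finite) chart \<Rightarrow> 'm \<Rightarrow> 'a \<Rightarrow> ('a, 'm) tvec \<Rightarrow> (real ^ 'm) \<times> (real ^ 'm)" where
  "ptm_coords c k p v = (snd c p, (1 / v c $ k) *\<^sub>R v c)"

definition isotropic_TM ::
    "('a, 'm::finite) chart set \<Rightarrow> ('a \<Rightarrow> ('a, 'm) tvec \<Rightarrow> real) \<Rightarrow> ('a \<times> ('a, 'm) tvec) set" where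
  "isotropic_TM A F = {(p, v). v \<in> tangent_space A p \<and> F p v = 0}"

definition isotropic_PTM ::
    "('a, 'm::finite) chart set \<Rightarrow> ('a \<Rightarrow> ('a, 'm) tvec \<Rightarrow> real) \<Rightarrow> ('a, 'm) chart \<Rightarrow> 'm
     \<Rightarrow> ((real ^ 'm) \<times> (real ^ 'm)) set" where
  "isotropic_PTM A F c k = {(x, p). x \<in> snd c ` fst c \<and> p $ k = 1 \<and> loc A c F (x, p) = 0}"

definition cramer_H :: "((real ^ 'm::finite) \<times> (real ^ 'm) \<Rightarrow> real) \<Rightarrow> (real ^ 'm) \<times> (real ^ 'm) \<Rightarrow> real" where
  "cramer_H G z = det (hess_v G z)"

definition cramer_rhs ::
    "((real ^ 'm::finite) \<times> (real ^ 'm) \<Rightarrow> real) \<Rightarrow> (real ^ 'm) \<times> (real ^ 'm) \<Rightarrow> real ^ 'm" where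
  "cramer_rhs G z = (\<chi> k. pd_x k G z - (\<Sum>j\<in>UNIV. pd_v k (pd_x j G) z * snd z $ j))"

definition cramer_Hi ::
    "'m \<Rightarrow> ((real ^ 'm::finite) \<times> (real ^ 'm) \<Rightarrow> real) \<Rightarrow> (real ^ 'm) \<times> (real ^ 'm) \<Rightarrow> real" where
  "cramer_Hi i G z =
     det (\<chi> r s. if s = i then cramer_rhs G z $ r else hess_v G z $ r $ s)"

text \<open>The field \<open>H (\<partial>_x + \<Sum> p_i \<partial>_{y_i}) + \<Sum> (H_i - p_i H_k) \<partial>_{p_i}\<close>. Its
  \<open>p_k\<close>-component vanishes on the slice \<open>p_k = 1\<close>.\<close>

definition proj_field ::
    "'m \<Rightarrow> ((real ^ 'm::finite) \<times> (real ^ 'm) \<Rightarrow> real) \<Rightarrow> (real ^ 'm) \<times> (real ^ 'm) \<Rightarrow> (real ^ 'm) \<times> (real ^ 'm)" where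
  "proj_field k G z =
     (cramer_H G z *\<^sub>R snd z, \<chi> i. cramer_Hi i G z - snd z $ i * cramer_Hi k G z)"

text \<open>Tangency is stated through velocities of curves lying in the set, rather than by \<open>dF(X) = 0\<close>,
  so that it retains its meaning where \<open>dF = 0\<close>; where \<open>dF \<noteq> 0\<close> the two agree.\<close>

definition field_tangent_to :: "('b::real_normed_vector \<Rightarrow> 'b) \<Rightarrow> 'b set \<Rightarrow> bool" where
  "field_tangent_to X S \<longleftrightarrow>
     (\<forall>z\<in>S. \<exists>g::real \<Rightarrow> 'b. g 0 = z \<and> (g has_vector_derivative X z) (at 0) \<and>
        (\<exists>\<epsilon>>0. \<forall>s. \<bar>s\<bar> < \<epsilon> \<longrightarrow> g s \<in> S))"

text \<open>An integral curve in \<open>PTM\<close> is given by its projection \<open>\<gamma>\<close> to \<open>M\<close> and a representative \<open>\<nu> t\<close> of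
  the direction over \<open>\<gamma> t\<close>. In each affine chart it is an immersed curve satisfying the Pfaffian
  equations \<open>dy_i = p_i dx\<close>, \<open>H dp_i = (H_i - p_i H_k) dx\<close>. These make sense also at the zeros of
  the vector field, which may fill an open set when the Hessian of \<open>F\<close> degenerates.\<close>

definition proj_integral_curve ::
    "('a::topological_space, 'm::finite) chart set \<Rightarrow> ('a \<Rightarrow> ('a, 'm) tvec \<Rightarrow> real)
     \<Rightarrow> real set \<Rightarrow> (real \<Rightarrow> 'a) \<Rightarrow> (real \<Rightarrow> ('a, 'm) tvec) \<Rightarrow> bool" where
  "proj_integral_curve A F I \<gamma> \<nu> \<longleftrightarrow>
     open_interval I \<and> continuous_on I \<gamma> \<and>
     (\<forall>t\<in>I. \<nu> t \<in> tangent_space A (\<gamma> t) \<and> \<nu> t \<noteq> (\<lambda>c. 0)) \<and>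
     (\<forall>t\<in>I. \<forall>c\<in>A. \<forall>k. \<gamma> t \<in> fst c \<and> 0 < \<nu> t c $ k \<longrightarrow>
        (let G = loc A c F; z = ptm_coords c k (\<gamma> t) (\<nu> t) in
         \<exists>x' p'. ((\<lambda>s. ptm_coords c k (\<gamma> s) (\<nu> s)) has_vector_derivative (x', p')) (at t) \<and>
           (x', p') \<noteq> (0, 0) \<and>
           (\<forall>i. x' $ i = snd z $ i * x' $ k) \<and>
           (\<forall>i. cramer_H G z * p' $ i =
                (cramer_Hi i G z - snd z $ i * cramer_Hi k G z) * x' $ k)))"

definition nonparam_extremal ::
    "('a::topological_space, 'm::finite) chart set \<Rightarrow> ('a \<Rightarrow> ('a, 'm) tvec \<Rightarrow> real)
     \<Rightarrow> real set \<Rightarrow> (real \<Rightarrow> 'a) \<Rightarrow> bool" where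
  "nonparam_extremal A F I \<gamma> \<longleftrightarrow>
     (\<exists>\<nu>. proj_integral_curve A F I \<gamma> \<nu>) \<and> \<not> \<gamma> constant_on I"

definition isotropic_line ::
    "('a::topological_space, 'm::finite) chart set \<Rightarrow> ('a \<Rightarrow> ('a, 'm) tvec \<Rightarrow> real)
     \<Rightarrow> real set \<Rightarrow> (real \<Rightarrow> 'a) \<Rightarrow> bool" where
  "isotropic_line A F I \<gamma> \<longleftrightarrow>
     regular_curve A I \<gamma> \<and> (\<forall>t\<in>I. F (\<gamma> t) (velocity A \<gamma> t) = 0)"

end

theory Submission
  imports Defs
begin

text \<open>
  Write \<open>G(x; v)\<close> for the metric function in a chart, \<open>G_x\<close>, \<open>G_v\<close> for its gradients, \<open>B = G_vv\<close> for
  the vertical Hessian, \<open>b\<close> for the right-hand side of the Euler--Lagrange system solved for the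
  acceleration, \<open>H = det B\<close>, and \<open>h\<close> for the vector of Cramer determinants \<open>H_i\<close>. Everything
  rests on Euler's identities for homogeneous functions: \<open>G_v . v = n G\<close>,
  \<open>B v = v\<^sup>T B = (n - 1) G_v\<close> and \<open>v . b = (1 - n) G_x . v\<close>.

  \<^emph>\<open>The Euler--Lagrange system.\<close> Contracting the system with \<open>v\<close> turns it into
  \<open>(n - 1) (G_x . v + G_v . a) = 0\<close>, where \<open>a\<close> is the acceleration. Hence \<open>G\<close> itself is constant
  along solutions (it is \<open>1 / (n - 1)\<close> times the energy), and a solution that is isotropic at one
  instant stays isotropic (\<open>EL_solution_energy_constant\<close>).

  \<^emph>\<open>The projectivized field.\<close> Cramer's rule in the form \<open>B h = H b\<close> also holds for singular \<open>B\<close>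
  (\<open>matrix_times_cramer_determinants\<close>). Contracting with \<open>v\<close> gives \<open>G_v . h = - H G_x . v\<close>, so on
  \<open>G = 0\<close>, where \<open>G_v . v = 0\<close>, the field \<open>X = (H p, h - h_k p)\<close> satisfies \<open>dG(X) = 0\<close>
  (\<open>proj_field_annihilates\<close>). Wherever \<open>G_v\<close> does not vanish, \<open>dG\<close> is nonzero on a coordinate
  direction of the slice \<open>p_k = 1\<close>, and an intermediate value argument produces a curve in
  \<open>G = 0\<close> with velocity \<open>X\<close> (\<open>level_set_curve\<close>). If \<open>G_v = 0\<close>, then \<open>B p = 0\<close>, hence \<open>H = 0\<close>, and
  \<open>h\<close> is proportional to the kernel vector \<open>p\<close>, so \<open>X = 0\<close> and a constant curve will do
  (\<open>proj_field_zero_where_vertical_gradient_zero\<close>). This covers the degenerate points of the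
  Hessian as well.

  \<^emph>\<open>Dimension two.\<close> Lift an isotropic line by its velocity. Differentiating \<open>G(x, p) = 0\<close> along the
  line shows that the velocity of the lift is annihilated by \<open>dG\<close>, as is \<open>X\<close>. The lift also
  satisfies \<open>dy = p dx\<close>, so \<open>H\<close> times its velocity and \<open>dx_k\<close> times \<open>X\<close> differ only in the one
  remaining direction of \<open>p\<close>. If \<open>dG\<close> is nonzero on that direction, the difference vanishes;
  otherwise \<open>X = 0\<close> and the Pfaffian equations hold trivially (\<open>two_dim_isotropic_velocity\<close>).
\<close>

section \<open>Cramer's rule for singular matrices\<close>

lemma singular_matrix_has_kernel:
  fixes A :: "real^'n^'n"
  shows "det A = 0 \<longleftrightarrow> (\<exists>u. u \<noteq> 0 \<and> A *v u = 0)"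
  by (metis invertible_det_nz matrix_left_invertible_ker invertible_left_inverse matrix_vector_mult_0_right)

definition replace_column :: "'n \<Rightarrow> real^'n \<Rightarrow> real^'n^'n \<Rightarrow> real^'n^'n" where
  "replace_column i b A = (\<chi> r s. if s = i then b $ r else A $ r $ s)"

lemma det_replace_column_scaleR:
  "det (replace_column i (a *\<^sub>R b) A) = a * det (replace_column i b A)"
proof -
  have T: "transpose (replace_column i c A) = (\<chi> s. if s = i then c else column s A)" for c
    by (simp add: replace_column_def transpose_def vec_eq_iff column_def)
  have "det (transpose (replace_column i (a *\<^sub>R b) A)) = a * det (transpose (replace_column i b A))"
    unfolding T scalar_mult_eq_scaleR[symmetric]
    by (rule det_row_mul[of i a "\<lambda>_. b" "\<lambda>s. column s A"])
  then show ?thesis by (simp add: det_transpose)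
qed

lemma det_replace_two_columns_swap:
  assumes "i \<noteq> l"
  shows "det (replace_column i (column l A) (replace_column l b A)) = - det (replace_column i b A)"
proof -
  have "replace_column i (column l A) (replace_column l b A)
      = (\<chi> r s. replace_column i b A $ r $ Transposition.transpose i l s)"
    using assms by (auto simp: replace_column_def vec_eq_iff column_def Transposition.transpose_def)
  then show ?thesis
    using det_permute_columns[of "Transposition.transpose i l" "replace_column i b A"] assms
    by (simp add: permutes_swap_id sign_swap_id)
qed

text \<open>A kernel vector \<open>u\<close> expresses \<open>u_l\<close> times column \<open>l\<close> through the other columns. Putting this
  combination into column \<open>i\<close> of the matrix that has \<open>b\<close> in column \<open>l\<close> leaves, by multilinearity,
  the term with column \<open>i\<close> itself; exchanging the two columns relates it to the determinant with
  \<open>b\<close> in column \<open>i\<close>. Thus the vector of Cramer determinants is proportional to \<open>u\<close>.\<close>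

lemma cramer_determinants_along_kernel:
  fixes A :: "real^'n^'n"
  assumes "A *v u = 0"
  shows "det (replace_column i b A) * u $ l = det (replace_column l b A) * u $ i"
proof (cases "i = l")
  case False
  let ?M = "replace_column l b A"
  \<comment> \<open>Deleting the \<open>l\<close>-th entry of \<open>u\<close> gives the coefficients of \<open>- u_l\<close> times column \<open>l\<close>.\<close>
  define x where "x = (\<chi> s. if s = l then 0 else u $ s)"
  have "(?M *v x) $ r = - u $ l * column l A $ r" for r
  proof -
    have "(\<Sum>s\<in>UNIV. A $ r $ s * u $ s) = 0"
      using assms by (simp add: matrix_vector_mult_def vec_eq_iff)
    moreover have "(\<Sum>s\<in>UNIV. A $ r $ s * u $ s) = A $ r $ l * u $ l + (\<Sum>s\<in>UNIV-{l}. A $ r $ s * u $ s)"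
      by (simp add: sum.remove)
    moreover have "(?M *v x) $ r = (\<Sum>s\<in>UNIV-{l}. A $ r $ s * u $ s)"
      by (simp add: matrix_vector_mult_def replace_column_def x_def sum.remove[of UNIV l])
    ultimately show ?thesis by (simp add: column_def mult.commute)
  qed
  then have "?M *v x = (- u $ l) *\<^sub>R column l A"
    by (simp add: vec_eq_iff)
  moreover have "det (replace_column i (?M *v x) ?M) = u $ i * det ?M"
    using cramer_lemma[of i ?M x] False
    unfolding replace_column_def[of i "?M *v x" ?M] by (simp add: x_def)
  ultimately have "- u $ l * det (replace_column i (column l A) ?M) = u $ i * det ?M"
    by (simp only: det_replace_column_scaleR)
  then show ?thesis
    using det_replace_two_columns_swap[OF False, of A b] by (simp add: mult.commute)
qed simp

text \<open>This is \<open>B adj(B) = det B\<close> applied to \<open>b\<close>. In the singular case the Cramer determinants are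
  proportional to a kernel vector, and both sides vanish.\<close>

lemma matrix_times_cramer_determinants:
  fixes A :: "real^'n^'n"
  shows "A *v (\<chi> i. det (replace_column i b A)) = det A *\<^sub>R b"
proof (cases "det A = 0")
  case True
  then obtain u where u: "u \<noteq> 0" "A *v u = 0"
    using singular_matrix_has_kernel by blast
  then obtain l where l: "u $ l \<noteq> 0" by (auto simp: vec_eq_iff)
  have "(\<chi> i. det (replace_column i b A)) = (det (replace_column l b A) / u $ l) *\<^sub>R u"
    using cramer_determinants_along_kernel[OF u(2), of _ b l] l by (simp add: vec_eq_iff field_simps)
  then show ?thesis using u True by (simp add: matrix_vector_mult_scaleR)
next
  case False
  have "(\<chi> i. det (replace_column i b A)) = det A *\<^sub>R (\<chi> k. det (\<chi> i j. if j = k then b $ i else A $ i $ j) / det A)"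
    using False by (simp add: vec_eq_iff replace_column_def)
  moreover have "A *v (\<chi> k. det (\<chi> i j. if j = k then b $ i else A $ i $ j) / det A) = b"
    using cramer[OF False] by blast
  ultimately show ?thesis by (simp add: matrix_vector_mult_scaleR)
qed

section \<open>Curves in level sets\<close>

text \<open>An implicit function statement that asks for differentiability at the single point \<open>z\<close>. On the
  segment \<open>z + s X + t W\<close> with \<open>|t| \<le> \<eta> |s|\<close> the function is \<open>t D W + o(s)\<close>, so it changes sign and
  has a zero there for all small \<open>s\<close>. Such zeros need not be unique; choosing one with least \<open>|t|\<close>
  gives one function \<open>\<tau>\<close> with \<open>|\<tau> s| \<le> \<eta> |s|\<close> for every \<open>\<eta>\<close> once \<open>s\<close> is small, hence \<open>\<tau>' 0 = 0\<close>.\<close>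

lemma level_set_curve:
  fixes G :: "'a::real_normed_vector \<Rightarrow> real"
  assumes U: "open U" "z \<in> U" and cont: "continuous_on U G"
    and D: "(G has_derivative D) (at z)" and "G z = 0" "D X = 0" "D W \<noteq> 0"
  obtains \<tau> \<epsilon> where "\<tau> 0 = 0" "(\<tau> has_real_derivative 0) (at 0)" "\<epsilon> > 0"
    "\<And>s::real. \<bar>s\<bar> < \<epsilon> \<Longrightarrow> G (z + s *\<^sub>R X + \<tau> s *\<^sub>R W) = 0"
proof -
  define \<phi> where "\<phi> s t = G (z + s *\<^sub>R X + t *\<^sub>R W)" for s t :: real
  define a where "a = D W"
  define L where "L = norm X + norm W + 1"
  have "a \<noteq> 0" "L > 0" using assms by (auto simp: a_def L_def add_nonneg_pos)
  interpret D: bounded_linear D using D by (rule has_derivative_bounded_linear)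
  obtain r where r: "r > 0" "ball z r \<subseteq> U" using U open_contains_ball by blast
  have disp: "norm (s *\<^sub>R X + t *\<^sub>R W) \<le> \<bar>s\<bar> * L" if "\<bar>t\<bar> \<le> \<bar>s\<bar>" for s t
  proof -
    have "norm (s *\<^sub>R X + t *\<^sub>R W) \<le> \<bar>s\<bar> * norm X + \<bar>t\<bar> * norm W"
      by (metis norm_scaleR norm_triangle_ineq)
    also have "\<dots> \<le> \<bar>s\<bar> * norm X + \<bar>s\<bar> * norm W"
      using that by (simp add: mult_right_mono)
    finally show ?thesis by (simp add: L_def algebra_simps)
  qed
  have inU: "z + s *\<^sub>R X + t *\<^sub>R W \<in> U" if "\<bar>t\<bar> \<le> \<bar>s\<bar>" "\<bar>s\<bar> < r / L" for s t
  proof -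
    have "norm (s *\<^sub>R X + t *\<^sub>R W) < r"
      using disp[OF that(1)] that(2) \<open>L > 0\<close> by (simp add: field_simps)
    then show ?thesis using r(2) by (auto simp: dist_norm norm_minus_commute add.assoc subset_iff)
  qed
  have cont\<phi>: "continuous_on {-\<bar>s\<bar>..\<bar>s\<bar>} (\<phi> s)" if "\<bar>s\<bar> < r / L" for s
    unfolding \<phi>_def
    by (rule continuous_on_compose2[OF cont]) (use that in \<open>auto intro!: inU continuous_intros\<close>)
  have zero: "\<exists>d>0. \<forall>s. \<bar>s\<bar> < d \<longrightarrow> (\<exists>t. \<bar>t\<bar> \<le> \<eta> * \<bar>s\<bar> \<and> \<phi> s t = 0)" if "0 < \<eta>" "\<eta> \<le> 1" for \<eta>
  proof -
    \<comment> \<open>With this tolerance the error is at most half of the linear term at \<open>t = \<plusminus>\<eta> |s|\<close>.\<close>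
    define e where "e = \<eta> * \<bar>a\<bar> / (2 * L)"
    have "e > 0" using that \<open>L > 0\<close> \<open>a \<noteq> 0\<close> by (simp add: e_def)
    then obtain d where d: "d > 0" "\<And>y. norm (y - z) < d \<Longrightarrow> \<bar>G y - G z - D (y - z)\<bar> \<le> e * norm (y - z)"
      using D unfolding has_derivative_at_alt by (metis real_norm_def)
    have "\<exists>t. \<bar>t\<bar> \<le> \<eta> * \<bar>s\<bar> \<and> \<phi> s t = 0" if s: "\<bar>s\<bar> < min (d / L) (r / L)" for s
    proof (cases "s = 0")
      case True
      then show ?thesis using \<open>G z = 0\<close> by (auto simp: \<phi>_def)
    next
      case False
      have le: "\<eta> * \<bar>s\<bar> \<le> \<bar>s\<bar>" using \<open>\<eta> \<le> 1\<close> by (simp add: mult_left_le_one_le \<open>0 < \<eta>\<close> less_imp_le)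
      have approx: "\<bar>\<phi> s t - t * a\<bar> \<le> \<eta> * \<bar>s\<bar> * \<bar>a\<bar> / 2" if "\<bar>t\<bar> \<le> \<bar>s\<bar>" for t
      proof -
        have "norm (s *\<^sub>R X + t *\<^sub>R W) < d"
          using disp[OF that] s \<open>L > 0\<close> by (simp add: field_simps)
        then have "\<bar>\<phi> s t - D (s *\<^sub>R X + t *\<^sub>R W)\<bar> \<le> e * norm (s *\<^sub>R X + t *\<^sub>R W)"
          using d(2)[of "z + s *\<^sub>R X + t *\<^sub>R W"] \<open>G z = 0\<close> by (simp add: \<phi>_def add.assoc)
        also have "\<dots> \<le> e * (\<bar>s\<bar> * L)" using disp[OF that] \<open>e > 0\<close> by simp
        also have "\<dots> = \<eta> * \<bar>s\<bar> * \<bar>a\<bar> / 2" using \<open>L > 0\<close> by (simp add: e_def)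
        finally show ?thesis using \<open>D X = 0\<close> by (simp add: D.add D.scaleR a_def)
      qed
      define h where "h = \<eta> * \<bar>s\<bar>"
      have h: "0 < h" "\<bar>h\<bar> \<le> \<bar>s\<bar>" using False \<open>0 < \<eta>\<close> le by (auto simp: h_def)
      have sub: "continuous_on {-h..h} (\<phi> s)"
        by (rule continuous_on_subset[OF cont\<phi>]) (use s h in auto)
      have bnd: "\<bar>\<phi> s h - h * a\<bar> \<le> h * \<bar>a\<bar> / 2" "\<bar>\<phi> s (-h) + h * a\<bar> \<le> h * \<bar>a\<bar> / 2"
        using approx[of h] approx[of "-h"] h by (auto simp: h_def)
      have pos: "h * \<bar>a\<bar> > 0" using h \<open>a \<noteq> 0\<close> by simp
      consider "\<phi> s (-h) \<le> 0" "0 \<le> \<phi> s h" | "\<phi> s h \<le> 0" "0 \<le> \<phi> s (-h)"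
      proof (cases "a > 0")
        case True
        then have "\<bar>a\<bar> = a" by simp
        have "\<phi> s (-h) \<le> 0" "0 \<le> \<phi> s h" using bnd pos unfolding \<open>\<bar>a\<bar> = a\<close> by linarith+
        then show ?thesis by (rule that(1))
      next
        case False
        then have "\<bar>a\<bar> = - a" by simp
        have "\<phi> s h \<le> 0" "0 \<le> \<phi> s (-h)" using bnd pos unfolding \<open>\<bar>a\<bar> = - a\<close> mult_minus_right by linarith+
        then show ?thesis by (rule that(2))
      qed
      then have "\<exists>t. -h \<le> t \<and> t \<le> h \<and> \<phi> s t = 0"
        using IVT'[of "\<phi> s" "-h" 0 h, OF _ _ _ sub] IVT2'[of "\<phi> s" h 0 "-h", OF _ _ _ sub] h(1)
        by cases auto
      then show ?thesis by (auto simp: h_def abs_le_iff)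
    qed
    then show ?thesis using d(1) r(1) \<open>L > 0\<close>
      by (intro exI[of _ "min (d / L) (r / L)"]) auto
  qed
  define least where "least s t \<longleftrightarrow> \<phi> s t = 0 \<and> (\<forall>t'. \<phi> s t' = 0 \<longrightarrow> \<bar>t\<bar> \<le> \<bar>t'\<bar>)" for s t
  define \<tau> where "\<tau> s = (SOME t. least s t)" for s
  obtain d1 where d1: "d1 > 0" "\<And>s. \<bar>s\<bar> < d1 \<Longrightarrow> \<exists>t. \<bar>t\<bar> \<le> \<bar>s\<bar> \<and> \<phi> s t = 0"
    using zero[of 1] by auto
  define \<epsilon> where "\<epsilon> = min d1 (r / L)"
  have least: "least s (\<tau> s)" if s: "\<bar>s\<bar> < \<epsilon>" for s
  proof -
    let ?Z = "{t \<in> {-\<bar>s\<bar>..\<bar>s\<bar>}. \<phi> s t = 0}"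
    have "closed ?Z"
      using continuous_closed_preimage_constant[OF cont\<phi>[of s], of 0] s by (simp add: \<epsilon>_def)
    then have "compact ?Z"
      using compact_Int_closed[OF compact_Icc[of "-\<bar>s\<bar>" "\<bar>s\<bar>"], of ?Z] by (simp add: Int_absorb1 Collect_mono_iff Int_def conj_ac cong: conj_cong)
    moreover have "?Z \<noteq> {}" using d1(2)[of s] s by (auto simp: \<epsilon>_def abs_le_iff)
    moreover have "continuous_on ?Z (\<lambda>t. \<bar>t\<bar>)" by (intro continuous_intros)
    ultimately obtain t where t: "t \<in> ?Z" "\<forall>t'\<in>?Z. \<bar>t\<bar> \<le> \<bar>t'\<bar>"
      using continuous_attains_inf[of ?Z "\<lambda>t. \<bar>t\<bar>"] by blast
    have "least s t" unfolding least_def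
    proof (intro conjI allI impI)
      fix t' assume "\<phi> s t' = 0"
      then show "\<bar>t\<bar> \<le> \<bar>t'\<bar>" using t by (cases "\<bar>t'\<bar> \<le> \<bar>s\<bar>") (auto simp: abs_le_iff)
    qed (use t in auto)
    then show ?thesis unfolding \<tau>_def by (rule someI)
  qed
  have "\<epsilon> > 0" using d1 r \<open>L > 0\<close> by (simp add: \<epsilon>_def)
  have \<tau>0: "\<tau> 0 = 0"
    using least[of 0] \<open>\<epsilon> > 0\<close> \<open>G z = 0\<close> by (auto simp: least_def \<phi>_def dest!: spec[of _ 0])
  have "(\<tau> has_derivative (\<lambda>_. 0)) (at 0)"
    unfolding has_derivative_at_alt
  proof (intro conjI allI impI)
    fix e :: real assume "e > 0"
    then obtain d where d: "d > 0" "\<And>s. \<bar>s\<bar> < d \<Longrightarrow> \<exists>t. \<bar>t\<bar> \<le> min e 1 * \<bar>s\<bar> \<and> \<phi> s t = 0"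
      using zero[of "min e 1"] by auto
    have "\<bar>\<tau> s\<bar> \<le> e * \<bar>s\<bar>" if s: "\<bar>s\<bar> < min d \<epsilon>" for s
    proof -
      obtain t where t: "\<bar>t\<bar> \<le> min e 1 * \<bar>s\<bar>" "\<phi> s t = 0" using d(2)[of s] s by auto
      have "\<bar>\<tau> s\<bar> \<le> \<bar>t\<bar>" using least[of s] s t(2) by (simp add: least_def)
      also have "\<dots> \<le> min e 1 * \<bar>s\<bar>" by fact
      also have "\<dots> \<le> e * \<bar>s\<bar>" by (intro mult_right_mono) auto
      finally show ?thesis .
    qed
    then show "\<exists>d>0. \<forall>y. norm (y - 0) < d \<longrightarrow> norm (\<tau> y - \<tau> 0 - 0) \<le> e * norm (y - 0)"
      using d(1) \<open>\<epsilon> > 0\<close> \<tau>0 by (intro exI[of _ "min d \<epsilon>"]) auto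
  qed simp
  then have "(\<tau> has_real_derivative 0) (at 0)"
    by (simp add: has_field_derivative_def lambda_zero)
  then show ?thesis using that \<tau>0 \<open>\<epsilon> > 0\<close> least by (auto simp: least_def \<phi>_def)
qed

section \<open>Homogeneous functions of position and velocity\<close>

lemma smooth_on_imp_differentiable: "smooth_on f S \<Longrightarrow> x \<in> S \<Longrightarrow> f differentiable (at x)"
  unfolding smooth_on_def by (metis Ck_on.simps(2))

lemma smooth_on_directional_derivative:
  "smooth_on f S \<Longrightarrow> smooth_on (\<lambda>x. frechet_derivative f (at x) v) S"
  unfolding smooth_on_def by (metis Ck_on.simps(2))

lemma smooth_on_pd_x: "smooth_on K S \<Longrightarrow> smooth_on (pd_x i K) S"
  using smooth_on_directional_derivative[of K S "(axis i 1, 0)"] by (simp add: pd_x_def[abs_def])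

lemma smooth_on_pd_v: "smooth_on K S \<Longrightarrow> smooth_on (pd_v i K) S"
  using smooth_on_directional_derivative[of K S "(0, axis i 1)"] by (simp add: pd_v_def[abs_def])

lemma axis_component: "axis j (1::real) $ i = (if i = j then 1 else 0)"
  by (simp add: axis_def)

lemma vec_eq_sum_axis: "(x :: real^'m) = (\<Sum>i\<in>UNIV. x $ i *\<^sub>R axis i 1)"
  by (simp add: vec_eq_iff axis_def if_distrib cong: if_cong)

lemma frechet_derivative_eq_partials:
  fixes K :: "(real^'m::finite) \<times> (real^'m) \<Rightarrow> real"
  assumes "K differentiable (at z)"
  shows "frechet_derivative K (at z) (a, b)
    = (\<Sum>i\<in>UNIV. a $ i * pd_x i K z) + (\<Sum>i\<in>UNIV. b $ i * pd_v i K z)"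
proof -
  interpret D: bounded_linear "frechet_derivative K (at z)"
    using assms frechet_derivative_works has_derivative_bounded_linear by blast
  have "(a, b) = (\<Sum>i\<in>UNIV. a $ i *\<^sub>R (axis i 1, 0)) + (\<Sum>i\<in>UNIV. b $ i *\<^sub>R (0, axis i 1))"
    by (simp add: prod_eq_iff fst_sum snd_sum flip: vec_eq_sum_axis)
  then show ?thesis
    by (simp only: D.add D.sum D.scaleR pd_x_def pd_v_def real_scaleR_def)
qed

abbreviation slit :: "(real^'m::finite) set \<Rightarrow> ((real^'m) \<times> (real^'m)) set" where
  "slit U \<equiv> U \<times> (UNIV - {0})"

lemma open_slit: "open U \<Longrightarrow> open (slit U)"
  by (intro open_Times open_Diff) auto

definition homogeneous_on :: "real \<Rightarrow> (real^'m::finite) set \<Rightarrow> ((real^'m) \<times> (real^'m) \<Rightarrow> real) \<Rightarrow> bool" where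
  "homogeneous_on n U K \<longleftrightarrow> (\<forall>x\<in>U. \<forall>v. v \<noteq> 0 \<longrightarrow> (\<forall>r>0. K (x, r *\<^sub>R v) = r powr n * K (x, v)))"

lemma homogeneous_onD:
  "homogeneous_on n U K \<Longrightarrow> (x, v) \<in> slit U \<Longrightarrow> r > 0 \<Longrightarrow> K (x, r *\<^sub>R v) = r powr n * K (x, v)"
  by (simp add: homogeneous_on_def)

lemma euler_identity:
  fixes K :: "(real^'m::finite) \<times> (real^'m) \<Rightarrow> real"
  assumes hom: "homogeneous_on n U K" and z: "(x, v) \<in> slit U"
    and K: "K differentiable (at (x, v))"
  shows "(\<Sum>i\<in>UNIV. v $ i * pd_v i K (x, v)) = n * K (x, v)"
proof -
  let ?D = "frechet_derivative K (at (x, v))"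
  have "((\<lambda>r. (x, r *\<^sub>R v)) has_derivative (\<lambda>h. (0, h *\<^sub>R v))) (at (1::real))"
    by (auto intro!: derivative_eq_intros)
  moreover have "(K has_derivative ?D) (at (x, 1 *\<^sub>R v))"
    using K by (simp flip: frechet_derivative_works)
  ultimately have "((\<lambda>r. K (x, r *\<^sub>R v)) has_derivative (\<lambda>h. ?D (0, h *\<^sub>R v))) (at (1::real))"
    by (rule has_derivative_compose)
  moreover have "((\<lambda>r. K (x, r *\<^sub>R v)) has_derivative (\<lambda>h. h * (n * K (x, v)))) (at (1::real))"
  proof (rule has_derivative_transform_within_open)
    show "((\<lambda>r. r powr n * K (x, v)) has_derivative (\<lambda>h. h * (n * K (x, v)))) (at 1)"
      by (auto intro!: derivative_eq_intros)
    show "r powr n * K (x, v) = K (x, r *\<^sub>R v)" if "r \<in> {0<..}" for r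
      using homogeneous_onD[OF hom z] that by simp
  qed auto
  ultimately have "?D (0, 1 *\<^sub>R v) = 1 * (n * K (x, v))"
    by (metis (no_types, lifting) has_derivative_unique)
  then show ?thesis by (simp add: frechet_derivative_eq_partials[OF K])
qed

text \<open>Differentiate \<open>K(x, r v) = r\<^sup>n K(x, v)\<close> in \<open>(x, v)\<close>: derivatives in \<open>x\<close> keep the degree, derivatives in
  \<open>v\<close> lower it by one.\<close>

lemma frechet_derivative_homogeneous:
  fixes K :: "(real^'m::finite) \<times> (real^'m) \<Rightarrow> real"
  assumes hom: "homogeneous_on n U K" and U: "open U" and K: "\<And>z. z \<in> slit U \<Longrightarrow> K differentiable (at z)"
    and z: "(x, v) \<in> slit U" and r: "r > 0"
  shows "frechet_derivative K (at (x, r *\<^sub>R v)) (a, r *\<^sub>R b)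
    = r powr n * frechet_derivative K (at (x, v)) (a, b)"
proof -
  have "((\<lambda>z. (fst z, r *\<^sub>R snd z)) has_derivative (\<lambda>h. (fst h, r *\<^sub>R snd h))) (at (x, v))"
    by (auto intro!: derivative_eq_intros)
  moreover have "(K has_derivative frechet_derivative K (at (x, r *\<^sub>R v))) (at (fst (x, v), r *\<^sub>R snd (x, v)))"
    using K[of "(x, r *\<^sub>R v)"] z r frechet_derivative_works by auto
  ultimately have "((\<lambda>z. K (fst z, r *\<^sub>R snd z)) has_derivative
      (\<lambda>h. frechet_derivative K (at (x, r *\<^sub>R v)) (fst h, r *\<^sub>R snd h))) (at (x, v))"
    by (rule has_derivative_compose)
  moreover have "((\<lambda>z. K (fst z, r *\<^sub>R snd z)) has_derivative
      (\<lambda>h. r powr n * frechet_derivative K (at (x, v)) h)) (at (x, v))"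
  proof (rule has_derivative_transform_within_open[OF _ open_slit[OF U] z])
    show "((\<lambda>z. r powr n * K z) has_derivative (\<lambda>h. r powr n * frechet_derivative K (at (x, v)) h)) (at (x, v))"
      using K[OF z] frechet_derivative_works has_derivative_mult_right by blast
    show "r powr n * K w = K (fst w, r *\<^sub>R snd w)" if "w \<in> slit U" for w
      using homogeneous_onD[OF hom, of "fst w" "snd w" r] that r by simp
  qed
  ultimately show ?thesis
    by (drule_tac has_derivative_unique) (auto dest!: fun_cong[of _ _ "(a, b)"])
qed

lemma homogeneous_on_pd_x:
  fixes K :: "(real^'m::finite) \<times> (real^'m) \<Rightarrow> real"
  assumes "homogeneous_on n U K" "open U" "\<And>z. z \<in> slit U \<Longrightarrow> K differentiable (at z)"
  shows "homogeneous_on n U (pd_x i K)"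
  unfolding homogeneous_on_def
proof (intro ballI allI impI)
  fix x v :: "real^'m" and r :: real assume "x \<in> U" "v \<noteq> 0" "r > 0"
  then show "pd_x i K (x, r *\<^sub>R v) = r powr n * pd_x i K (x, v)"
    using frechet_derivative_homogeneous[OF assms, of x v r "axis i 1" 0] by (simp add: pd_x_def)
qed

lemma homogeneous_on_pd_v:
  fixes K :: "(real^'m::finite) \<times> (real^'m) \<Rightarrow> real"
  assumes "homogeneous_on n U K" "open U" and K: "\<And>z. z \<in> slit U \<Longrightarrow> K differentiable (at z)"
  shows "homogeneous_on (n - 1) U (pd_v i K)"
  unfolding homogeneous_on_def
proof (intro ballI allI impI)
  fix x v :: "real^'m" and r :: real assume *: "x \<in> U" "v \<noteq> 0" "r > 0"
  then have "bounded_linear (frechet_derivative K (at (x, r *\<^sub>R v)))"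
    using K[of "(x, r *\<^sub>R v)", THEN frechet_derivative_works[THEN iffD1], THEN has_derivative_bounded_linear]
    by simp
  then have "frechet_derivative K (at (x, r *\<^sub>R v)) (r *\<^sub>R (0, axis i 1))
      = r * frechet_derivative K (at (x, r *\<^sub>R v)) (0, axis i 1)"
    by (simp only: linear_simps real_scaleR_def)
  then have "r * pd_v i K (x, r *\<^sub>R v) = r powr n * pd_v i K (x, v)"
    using frechet_derivative_homogeneous[OF assms, of x v r 0 "axis i 1"] * by (simp add: pd_v_def)
  then show "pd_v i K (x, r *\<^sub>R v) = r powr (n - 1) * pd_v i K (x, v)"
    using *(3) by (simp add: powr_diff field_simps)
qed

text \<open>Here the contraction is over the inner index of the iterated partial derivative, whereas Euler's
  identity for \<open>pd_v j K\<close> contracts the outer one. Differentiating Euler's identity for \<open>K\<close> itself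
  yields this version.\<close>

lemma derivative_of_euler_identity:
  fixes K :: "(real^'m::finite) \<times> (real^'m) \<Rightarrow> real"
  assumes hom: "homogeneous_on n U K" and U: "open U" and K: "smooth_on K (slit U)"
    and z: "(x, v) \<in> slit U"
  shows "(\<Sum>i\<in>UNIV. v $ i * pd_v j (pd_v i K) (x, v)) = (n - 1) * pd_v j K (x, v)"
proof -
  let ?z = "(x, v)"
  let ?D = "\<lambda>i. frechet_derivative (pd_v i K) (at ?z)"
  have d: "(pd_v i K has_derivative ?D i) (at ?z)" for i
    using smooth_on_imp_differentiable[OF smooth_on_pd_v[OF K] z] frechet_derivative_works by blast
  have "((\<lambda>w. \<Sum>i\<in>UNIV. snd w $ i * pd_v i K w) has_derivative
      (\<lambda>h. \<Sum>i\<in>UNIV. snd ?z $ i * ?D i h + snd h $ i * pd_v i K ?z)) (at ?z)"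
    by (intro has_derivative_sum has_derivative_mult d
        bounded_linear_imp_has_derivative bounded_linear_compose[OF bounded_linear_vec_nth bounded_linear_snd])
  then have "((\<lambda>w. n * K w) has_derivative
      (\<lambda>h. \<Sum>i\<in>UNIV. snd ?z $ i * ?D i h + snd h $ i * pd_v i K ?z)) (at ?z)"
  proof (rule has_derivative_transform_within_open[OF _ open_slit[OF U] z])
    fix w assume "w \<in> slit U"
    then show "(\<Sum>i\<in>UNIV. snd w $ i * pd_v i K w) = n * K w"
      using euler_identity[OF hom, of "fst w" "snd w"] smooth_on_imp_differentiable[OF K, of w] by (cases w) auto
  qed
  moreover have "((\<lambda>w. n * K w) has_derivative (\<lambda>h. n * frechet_derivative K (at ?z) h)) (at ?z)"
    using smooth_on_imp_differentiable[OF K z] frechet_derivative_works has_derivative_mult_right by blast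
  ultimately have "(\<Sum>i\<in>UNIV. v $ i * ?D i (0, axis j 1) + axis j 1 $ i * pd_v i K ?z)
      = n * frechet_derivative K (at ?z) (0, axis j 1)"
    by (drule_tac has_derivative_unique) (auto dest!: fun_cong[of _ _ "(0, axis j 1)"])
  then show ?thesis
    by (simp add: sum.distrib left_diff_distrib axis_component if_distrib[of "\<lambda>x. x * _"] flip: pd_v_def cong: if_cong)
qed

section \<open>The isotropic hypersurface in one chart\<close>

text \<open>The coordinate expression of the metric function in one chart, with \<open>U\<close> the image of the chart.\<close>

locale homogeneous_lagrangian =
  fixes U :: "(real^'m::finite) set" and n :: real and G :: "(real^'m) \<times> (real^'m) \<Rightarrow> real"
  assumes open_U: "open U" and smooth: "smooth_on G (slit U)"
    and hom: "homogeneous_on n U G" and n_ge_2: "n \<ge> 2"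
begin

lemma lagrangian_differentiable: "z \<in> slit U \<Longrightarrow> G differentiable (at z)"
  using smooth smooth_on_imp_differentiable by blast

lemma euler_lagrangian: "(x, v) \<in> slit U \<Longrightarrow> (\<Sum>i\<in>UNIV. v $ i * pd_v i G (x, v)) = n * G (x, v)"
  using euler_identity hom lagrangian_differentiable by blast

lemma euler_pd_x:
  "(x, v) \<in> slit U \<Longrightarrow> (\<Sum>i\<in>UNIV. v $ i * pd_v i (pd_x j G) (x, v)) = n * pd_x j G (x, v)"
  using euler_identity[OF homogeneous_on_pd_x[OF hom open_U lagrangian_differentiable]]
    smooth_on_imp_differentiable[OF smooth_on_pd_x[OF smooth]] by blast

lemma euler_pd_v:
  "(x, v) \<in> slit U \<Longrightarrow> (\<Sum>i\<in>UNIV. v $ i * pd_v i (pd_v j G) (x, v)) = (n - 1) * pd_v j G (x, v)"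
  using euler_identity[OF homogeneous_on_pd_v[OF hom open_U lagrangian_differentiable]]
    smooth_on_imp_differentiable[OF smooth_on_pd_v[OF smooth]] by blast

lemma hessian_times_velocity:
  assumes z: "(x, v) \<in> slit U"
  shows "hess_v G (x, v) *v v = (n - 1) *\<^sub>R (\<chi> i. pd_v i G (x, v))"
  using derivative_of_euler_identity[OF hom open_U smooth z]
  by (simp add: vec_eq_iff hess_v_def matrix_vector_mult_def mult.commute)

text \<open>Because \<open>pd_v j G\<close> and \<open>pd_x j G\<close> have degrees \<open>n - 1\<close> and \<open>n\<close>, contracting the Euler--Lagrange
  equations with \<open>v\<close> leaves \<open>n - 1\<close> times the derivative of \<open>G\<close> along a curve with velocity \<open>v\<close> and
  acceleration \<open>a\<close>.\<close>

lemma energy_conservation: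
  assumes z: "(x, v) \<in> slit U" and EL: "EL_equation G x v a"
  shows "frechet_derivative G (at (x, v)) (v, a) = 0"
proof -
  let ?z = "(x, v)"
  have "(\<Sum>i\<in>UNIV. v $ i * pd_x i G ?z)
      = (\<Sum>i\<in>UNIV. v $ i * ((\<Sum>j\<in>UNIV. pd_v i (pd_v j G) ?z * a $ j) + (\<Sum>j\<in>UNIV. pd_v i (pd_x j G) ?z * v $ j)))"
    using EL by (simp add: EL_equation_def)
  also have "\<dots> = (\<Sum>j\<in>UNIV. a $ j * (\<Sum>i\<in>UNIV. v $ i * pd_v i (pd_v j G) ?z))
       + (\<Sum>j\<in>UNIV. v $ j * (\<Sum>i\<in>UNIV. v $ i * pd_v i (pd_x j G) ?z))"
  proof -
    have "(\<Sum>i\<in>UNIV. \<Sum>j\<in>UNIV. v $ i * (pd_v i (pd_v j G) ?z * a $ j)) = (\<Sum>j\<in>UNIV. \<Sum>i\<in>UNIV. a $ j * (v $ i * pd_v i (pd_v j G) ?z))"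
      by (subst sum.swap) (simp add: mult_ac)
    moreover have "(\<Sum>i\<in>UNIV. \<Sum>j\<in>UNIV. v $ i * (pd_v i (pd_x j G) ?z * v $ j)) = (\<Sum>j\<in>UNIV. \<Sum>i\<in>UNIV. v $ j * (v $ i * pd_v i (pd_x j G) ?z))"
      by (subst sum.swap) (simp add: mult_ac)
    ultimately show ?thesis by (simp add: distrib_left sum.distrib sum_distrib_left)
  qed
  also have "\<dots> = (\<Sum>j\<in>UNIV. a $ j * ((n - 1) * pd_v j G ?z)) + (\<Sum>j\<in>UNIV. v $ j * (n * pd_x j G ?z))"
    by (simp only: euler_pd_v[OF z] euler_pd_x[OF z])
  also have "\<dots> = (n - 1) * (\<Sum>j\<in>UNIV. a $ j * pd_v j G ?z) + n * (\<Sum>j\<in>UNIV. v $ j * pd_x j G ?z)"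
    by (simp add: sum_distrib_left mult_ac)
  finally have "(n - 1) * ((\<Sum>j\<in>UNIV. v $ j * pd_x j G ?z) + (\<Sum>j\<in>UNIV. a $ j * pd_v j G ?z)) = 0"
    by (simp only: distrib_left left_diff_distrib)
  then show ?thesis
    using n_ge_2 by (simp add: frechet_derivative_eq_partials[OF lagrangian_differentiable[OF z]])
qed

lemma cramer_rhs_contraction:
  assumes z: "(x, v) \<in> slit U"
  shows "(\<Sum>i\<in>UNIV. v $ i * cramer_rhs G (x, v) $ i) = (1 - n) * (\<Sum>i\<in>UNIV. v $ i * pd_x i G (x, v))"
proof -
  have "(\<Sum>i\<in>UNIV. v $ i * (\<Sum>j\<in>UNIV. pd_v i (pd_x j G) (x, v) * v $ j))
      = (\<Sum>j\<in>UNIV. v $ j * (\<Sum>i\<in>UNIV. v $ i * pd_v i (pd_x j G) (x, v)))"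
    unfolding sum_distrib_left by (subst sum.swap) (simp only: mult_ac)
  also have "\<dots> = n * (\<Sum>j\<in>UNIV. v $ j * pd_x j G (x, v))"
    unfolding euler_pd_x[OF z] by (simp only: sum_distrib_left mult_ac)
  finally have eq: "(\<Sum>i\<in>UNIV. v $ i * (\<Sum>j\<in>UNIV. pd_v i (pd_x j G) (x, v) * v $ j))
      = n * (\<Sum>j\<in>UNIV. v $ j * pd_x j G (x, v))" .
  have "(\<Sum>i\<in>UNIV. v $ i * cramer_rhs G (x, v) $ i) = (\<Sum>j\<in>UNIV. v $ j * pd_x j G (x, v))
      - (\<Sum>i\<in>UNIV. v $ i * (\<Sum>j\<in>UNIV. pd_v i (pd_x j G) (x, v) * v $ j))"
    by (simp add: cramer_rhs_def right_diff_distrib sum_subtractf)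
  then show ?thesis unfolding eq by (simp only: left_diff_distrib mult_1)
qed

lemma hessian_times_cramer:
  "hess_v G z *v (\<chi> i. cramer_Hi i G z) = cramer_H G z *\<^sub>R cramer_rhs G z"
  using matrix_times_cramer_determinants[of "hess_v G z" "cramer_rhs G z"]
  unfolding cramer_Hi_def cramer_H_def replace_column_def .

text \<open>Since \<open>(n - 1) G_v = v\<^sup>T B\<close>, the vertical part of \<open>dG(X)\<close> is computed by contracting \<open>B h = H b\<close> with
  \<open>v\<close>; it cancels the horizontal part \<open>H G_x . v\<close>. The term with \<open>H_k\<close> drops out because
  \<open>G_v . v = n G = 0\<close>.\<close>

lemma proj_field_annihilates:
  assumes z: "(x, v) \<in> slit U" and G0: "G (x, v) = 0"
  shows "frechet_derivative G (at (x, v)) (proj_field k G (x, v)) = 0"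
proof -
  let ?z = "(x, v)"
  let ?h = "\<chi> i. cramer_Hi i G ?z"
  let ?H = "cramer_H G ?z"
  have "(n - 1) * (\<Sum>j\<in>UNIV. ?h $ j * pd_v j G ?z)
      = (\<Sum>j\<in>UNIV. \<Sum>i\<in>UNIV. v $ i * (hess_v G ?z $ i $ j * ?h $ j))"
  proof -
    have "(n - 1) * (?h $ j * pd_v j G ?z) = (\<Sum>i\<in>UNIV. v $ i * (hess_v G ?z $ i $ j * ?h $ j))" for j
    proof -
      have "(n - 1) * (?h $ j * pd_v j G ?z) = ((n - 1) * pd_v j G ?z) * ?h $ j"
        by (simp only: mult_ac)
      then show ?thesis
        unfolding euler_pd_v[OF z, symmetric] sum_distrib_right by (simp add: hess_v_def mult.assoc)
    qed
    then show ?thesis by (simp only: sum_distrib_left)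
  qed
  also have "\<dots> = (\<Sum>i\<in>UNIV. v $ i * (hess_v G ?z *v ?h) $ i)"
    by (subst sum.swap) (simp add: matrix_vector_mult_def sum_distrib_left)
  also have "\<dots> = ?H * (\<Sum>i\<in>UNIV. v $ i * cramer_rhs G ?z $ i)"
    unfolding hessian_times_cramer sum_distrib_left vector_scaleR_component real_scaleR_def by (simp only: mult_ac)
  also have "\<dots> = (n - 1) * (- ?H * (\<Sum>i\<in>UNIV. v $ i * pd_x i G ?z))"
    unfolding cramer_rhs_contraction[OF z] by algebra
  finally have "(\<Sum>j\<in>UNIV. ?h $ j * pd_v j G ?z) = - ?H * (\<Sum>i\<in>UNIV. v $ i * pd_x i G ?z)"
    by (rule mult_left_cancel[THEN iffD1, rotated]) (use n_ge_2 in simp)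
  moreover have "(\<Sum>i\<in>UNIV. v $ i * pd_v i G ?z) = 0" using euler_lagrangian[OF z] G0 by simp
  moreover have "frechet_derivative G (at ?z) (proj_field k G ?z)
      = ?H * (\<Sum>i\<in>UNIV. v $ i * pd_x i G ?z)
        + ((\<Sum>i\<in>UNIV. ?h $ i * pd_v i G ?z) - cramer_Hi k G ?z * (\<Sum>i\<in>UNIV. v $ i * pd_v i G ?z))"
    unfolding proj_field_def frechet_derivative_eq_partials[OF lagrangian_differentiable[OF z]]
    by (simp add: left_diff_distrib right_diff_distrib sum_subtractf sum_distrib_left mult_ac)
  ultimately show ?thesis by simp
qed

text \<open>If \<open>G_v = 0\<close>, then \<open>v\<close> lies in the kernel of the Hessian, and the Cramer determinants are a multiple
  of \<open>v\<close>; the normalization \<open>v_k = 1\<close> identifies the factor as \<open>H_k\<close>.\<close>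

lemma proj_field_zero_where_vertical_gradient_zero:
  assumes z: "(x, v) \<in> slit U" and fv: "\<And>i. pd_v i G (x, v) = 0" and k: "v $ k = 1"
  shows "proj_field k G (x, v) = 0"
proof -
  let ?A = "hess_v G (x, v)"
  have "?A *v v = 0"
    by (simp add: hessian_times_velocity[OF z] fv vec_eq_iff)
  moreover have "v \<noteq> 0" using z by auto
  ultimately have "cramer_H G (x, v) = 0"
    unfolding cramer_H_def singular_matrix_has_kernel by blast
  moreover have w: "cramer_Hi i G (x, v) = v $ i * cramer_Hi k G (x, v)" for i
    using cramer_determinants_along_kernel[OF \<open>?A *v v = 0\<close>, of i "cramer_rhs G (x, v)" k] k
    by (simp add: cramer_Hi_def replace_column_def mult.commute)
  then have "(\<chi> i. cramer_Hi i G (x, v) - v $ i * cramer_Hi k G (x, v)) = 0"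
    by (simp only: vec_eq_iff vec_lambda_beta zero_index diff_self w[symmetric]) simp
  ultimately show ?thesis by (simp add: proj_field_def zero_prod_def)
qed

text \<open>Where the field does not vanish, \<open>G = 0\<close> can be solved for one of the coordinates \<open>p_j\<close> of the
  slice \<open>p_k = 1\<close>: by \<open>G_v . p = 0\<close> the gradient \<open>G_v\<close> cannot be concentrated in the \<open>k\<close>-th entry.\<close>

lemma vertical_gradient_off_axis:
  assumes z: "(x, p) \<in> slit U" and G0: "G (x, p) = 0" and k: "p $ k = 1"
    and X: "proj_field k G (x, p) \<noteq> 0"
  obtains j where "j \<noteq> k" "pd_v j G (x, p) \<noteq> 0"
proof -
  have "\<exists>j. j \<noteq> k \<and> pd_v j G (x, p) \<noteq> 0"
  proof (rule ccontr)
    assume none: "\<not> ?thesis"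
    then have "(\<Sum>i\<in>UNIV. p $ i * pd_v i G (x, p)) = p $ k * pd_v k G (x, p)"
      by (intro sum.mono_neutral_right[of UNIV "{k}", simplified, THEN trans]) auto
    then have "pd_v i G (x, p) = 0" for i
      using euler_lagrangian[OF z] G0 k none by (cases "i = k") auto
    then show False using proj_field_zero_where_vertical_gradient_zero[OF z _ k] X by blast
  qed
  then show ?thesis using that by blast
qed

text \<open>Along the curve \<open>z + s X\<close> both \<open>p_k = 1\<close> and membership of the base point in \<open>U\<close> persist; \<open>G = 0\<close> is
  restored by a correction of order \<open>o(s)\<close> of one coordinate \<open>p_j\<close> with \<open>j \<noteq> k\<close>, which disturbs
  neither.\<close>

lemma proj_field_tangent:
  "field_tangent_to (proj_field k G) {(x, p). x \<in> U \<and> p $ k = 1 \<and> G (x, p) = 0}"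
  (is "field_tangent_to ?X ?S")
  unfolding field_tangent_to_def
proof
  fix z assume "z \<in> ?S"
  then obtain x p where z: "z = (x, p)" "x \<in> U" "p $ k = 1" "G (x, p) = 0" by auto
  then have slit: "(x, p) \<in> slit U" by auto
  show "\<exists>g. g 0 = z \<and> (g has_vector_derivative ?X z) (at 0) \<and> (\<exists>\<epsilon>>0. \<forall>s. \<bar>s\<bar> < \<epsilon> \<longrightarrow> g s \<in> ?S)"
  proof (cases "?X z = 0")
    case True
    then show ?thesis using \<open>z \<in> ?S\<close> by (intro exI[of _ "\<lambda>_. z"]) (auto intro: exI[of _ "1::real"])
  next
    case False
    then obtain j where j: "j \<noteq> k" "pd_v j G z \<noteq> 0"
      using vertical_gradient_off_axis[OF slit] z by auto
    let ?W = "(0, axis j 1) :: (real^'m) \<times> (real^'m)"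
    have "continuous_on (slit U) G"
      using lagrangian_differentiable differentiable_imp_continuous_within continuous_at_imp_continuous_on by blast
    moreover have "(G has_derivative frechet_derivative G (at z)) (at z)"
      using lagrangian_differentiable[OF slit] z frechet_derivative_works by blast
    moreover have "frechet_derivative G (at z) (?X z) = 0"
      using proj_field_annihilates[OF slit] z by simp
    moreover have "frechet_derivative G (at z) ?W \<noteq> 0" using j by (simp add: pd_v_def)
    moreover have "G z = 0" "z \<in> slit U" using z slit by auto
    ultimately obtain \<tau> \<epsilon> where \<tau>: "\<tau> 0 = 0" "(\<tau> has_real_derivative 0) (at 0)" "\<epsilon> > 0"
        "\<And>s::real. \<bar>s\<bar> < \<epsilon> \<Longrightarrow> G (z + s *\<^sub>R ?X z + \<tau> s *\<^sub>R ?W) = 0"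
      using level_set_curve[OF open_slit[OF open_U]] by metis
    define g where "g s = z + s *\<^sub>R ?X z + \<tau> s *\<^sub>R ?W" for s
    have "(g has_vector_derivative (0 + 1 *\<^sub>R ?X z) + 0 *\<^sub>R ?W) (at 0)"
      unfolding g_def using \<tau>(2)
      by (auto intro!: derivative_eq_intros simp: has_vector_derivative_def has_field_derivative_def simp flip: zero_prod_def)
    then have gX: "(g has_vector_derivative ?X z) (at 0)" by (simp flip: zero_prod_def)
    obtain \<delta> where \<delta>: "\<delta> > 0" "\<And>s. \<bar>s\<bar> < \<delta> \<Longrightarrow> x + s *\<^sub>R fst (?X z) \<in> U"
    proof -
      have "open ((\<lambda>s::real. x + s *\<^sub>R fst (?X z)) -` U)"
        by (intro open_vimage open_U continuous_intros)
      moreover have "0 \<in> (\<lambda>s::real. x + s *\<^sub>R fst (?X z)) -` U" using z by simp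
      ultimately obtain \<delta> where "\<delta> > 0" "ball 0 \<delta> \<subseteq> (\<lambda>s::real. x + s *\<^sub>R fst (?X z)) -` U"
        using open_contains_ball by blast
      then show ?thesis using that by (auto simp: subset_iff)
    qed
    have gS: "g s \<in> ?S" if "\<bar>s\<bar> < min \<epsilon> \<delta>" for s
    proof -
      have "fst (g s) = x + s *\<^sub>R fst (?X z)" by (simp add: g_def z)
      moreover have "snd (g s) $ k = 1"
        using j(1) z by (simp add: g_def proj_field_def axis_def)
      moreover have "G (g s) = 0" using \<tau>(4)[of s] that by (simp add: g_def)
      ultimately show ?thesis using \<delta>(2)[of s] that by (cases "g s") auto
    qed
    have "g 0 = z" using \<tau>(1) by (simp add: g_def flip: zero_prod_def)
    moreover have "min \<epsilon> \<delta> > 0" using \<tau>(3) \<delta>(1) by simp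
    ultimately show ?thesis using gX gS by blast
  qed
qed

text \<open>The vector \<open>q\<close> below is the defect in the Pfaffian equation. Because \<open>dG\<close> kills both the field and
  the velocity of the lifted curve, it kills \<open>(0, q)\<close>. Now \<open>q_k = 0\<close>, and in the
  direction of the only other entry \<open>dG\<close> is nonzero, unless the field vanishes.\<close>

lemma two_dim_isotropic_velocity:
  assumes dim: "CARD('m) = 2"
    and z: "(x, p) \<in> slit U" and G0: "G (x, p) = 0" and k: "p $ k = 1"
    and x': "\<And>i. x' $ i = p $ i * x' $ k" and p': "p' $ k = 0"
    and D0: "frechet_derivative G (at (x, p)) (x', p') = 0"
  shows "cramer_H G (x, p) * p' $ i = (cramer_Hi i G (x, p) - p $ i * cramer_Hi k G (x, p)) * x' $ k"
proof (cases "proj_field k G (x, p) = 0")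
  case True
  then have "cramer_H G (x, p) = 0" "(\<chi> i. cramer_Hi i G (x, p) - p $ i * cramer_Hi k G (x, p)) = 0"
    using z by (auto simp: proj_field_def zero_prod_def)
  moreover from this(2) have "cramer_Hi i G (x, p) - p $ i * cramer_Hi k G (x, p) = 0"
    unfolding vec_eq_iff by (simp only: vec_lambda_beta zero_index)
  ultimately show ?thesis by (simp only: mult_zero_left)
next
  case False
  then obtain j where j: "j \<noteq> k" "pd_v j G (x, p) \<noteq> 0"
    using vertical_gradient_off_axis[OF z G0 k] by blast
  have UNIV: "UNIV = {k, j}"
    using card_subset_eq[of "UNIV :: 'm set" "{k, j}"] j(1) dim by (simp add: card_insert_if)
  let ?D = "frechet_derivative G (at (x, p))" and ?X = "proj_field k G (x, p)"
  define q where "q = cramer_H G (x, p) *\<^sub>R p' - x' $ k *\<^sub>R snd ?X"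
  interpret D: bounded_linear ?D
    using lagrangian_differentiable[OF z] frechet_derivative_works has_derivative_bounded_linear by blast
  have "x' = x' $ k *\<^sub>R p"
    by (rule vec_eq_iff[THEN iffD2, rule_format]) (subst x', simp add: mult.commute)
  then have "cramer_H G (x, p) *\<^sub>R x' = cramer_H G (x, p) *\<^sub>R (x' $ k *\<^sub>R p)"
    by (rule arg_cong)
  also have "\<dots> = x' $ k *\<^sub>R fst ?X"
    by (simp add: proj_field_def mult.commute)
  finally have "cramer_H G (x, p) *\<^sub>R x' = x' $ k *\<^sub>R fst ?X" .
  then have "(0, q) = cramer_H G (x, p) *\<^sub>R (x', p') - x' $ k *\<^sub>R ?X"
    by (simp add: q_def prod_eq_iff)
  then have "?D (0, q) = 0"
    by (simp only: D.diff D.scaleR D0 proj_field_annihilates[OF z G0]) simp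
  moreover have "q $ k = 0" using p' k by (simp add: q_def proj_field_def)
  ultimately have "q $ j = 0"
    using j by (simp add: frechet_derivative_eq_partials[OF lagrangian_differentiable[OF z]] UNIV)
  with \<open>q $ k = 0\<close> have "q $ i = 0" using UNIV by (metis UNIV_I insert_iff singletonD)
  then show ?thesis by (simp add: q_def proj_field_def mult.commute)
qed

end

section \<open>Charts and tangent vectors\<close>

lemma has_vector_derivative_along_curve:
  assumes "(z has_vector_derivative z') (at t)" "(f has_derivative D) (at (z t))"
  shows "((\<lambda>s. f (z s)) has_vector_derivative D z') (at t)"
  using vector_derivative_diff_chain_within[of z z' t UNIV f D] assms
  by (simp add: o_def has_derivative_at_withinI)

locale manifold_atlas =
  fixes A :: "('a::{t2_space, second_countable_topology}, 'm::finite) chart set"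
  assumes smooth_manifold: "smooth_manifold A"
begin

lemma
  assumes "c \<in> A"
  shows open_chart_domain: "open (fst c)" and open_chart_image: "open (snd c ` fst c)"
    and chart_homeomorphism: "homeomorphism (fst c) (snd c ` fst c) (snd c) (chart_inv c)"
  using assms smooth_manifold by (auto simp: smooth_manifold_def is_chart_def)

lemma chart_inv_chart [simp]: "c \<in> A \<Longrightarrow> p \<in> fst c \<Longrightarrow> chart_inv c (snd c p) = p"
  using chart_homeomorphism homeomorphism_apply1 by blast

lemma chart_around: obtains c where "c \<in> A" "p \<in> fst c"
  using smooth_manifold unfolding smooth_manifold_def by blast

lemma open_chart_overlap:
  assumes "c \<in> A" "d \<in> A"
  shows "open (snd c ` (fst c \<inter> fst d))"
proof -
  have "snd c ` (fst c \<inter> fst d) = snd c ` fst c \<inter> chart_inv c -` fst d"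
    using assms by (auto simp: image_iff)
  moreover have "open (snd c ` fst c \<inter> chart_inv c -` fst d)"
    using assms
    by (intro continuous_open_preimage open_chart_image open_chart_domain
        homeomorphism_cont2[OF chart_homeomorphism])
  ultimately show ?thesis by simp
qed

lemma transition_differentiable:
  assumes "c \<in> A" "d \<in> A" "p \<in> fst c \<inter> fst d"
  shows "(snd d \<circ> chart_inv c) differentiable (at (snd c p))"
proof -
  have "smooth_on (snd d \<circ> chart_inv c) (snd c ` (fst c \<inter> fst d))"
    using smooth_manifold assms unfolding smooth_manifold_def compatible_def by blast
  then show ?thesis using assms(3) by (intro smooth_on_imp_differentiable) auto
qed

lemma transition_has_derivative:
  assumes "c \<in> A" "d \<in> A" "p \<in> fst c \<inter> fst d"
  shows "((snd d \<circ> chart_inv c) has_derivative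
    frechet_derivative (snd d \<circ> chart_inv c) (at (snd c p))) (at (snd c p))"
  using transition_differentiable[OF assms] frechet_derivative_works by blast

text \<open>The chain rule for transition maps; it makes the components of \<open>tvec_of\<close> compatible with each other.\<close>

lemma transition_cocycle:
  assumes c: "c \<in> A" and d: "d \<in> A" and e: "e \<in> A" and p: "p \<in> fst c" "p \<in> fst d" "p \<in> fst e"
  shows "frechet_derivative (snd e \<circ> chart_inv c) (at (snd c p)) u
    = frechet_derivative (snd e \<circ> chart_inv d) (at (snd d p))
        (frechet_derivative (snd d \<circ> chart_inv c) (at (snd c p)) u)"
proof -
  let ?ec = "snd e \<circ> chart_inv c" and ?ed = "snd e \<circ> chart_inv d" and ?dc = "snd d \<circ> chart_inv c"
  have "(?ed has_derivative frechet_derivative ?ed (at (snd d p))) (at (?dc (snd c p)))"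
    using transition_has_derivative[OF d e, of p] c p by simp
  then have "(?ed \<circ> ?dc has_derivative frechet_derivative ?ed (at (snd d p)) \<circ> frechet_derivative ?dc (at (snd c p))) (at (snd c p))"
    using transition_has_derivative[OF c d, of p] p by (intro diff_chain_at) auto
  then have "(?ec has_derivative frechet_derivative ?ed (at (snd d p)) \<circ> frechet_derivative ?dc (at (snd c p))) (at (snd c p))"
    by (rule has_derivative_transform_within_open[OF _ open_chart_overlap[OF c d]]) (use c d p in auto)
  from frechet_derivative_at[OF this, symmetric] show ?thesis by simp
qed

lemma tvec_of_in_tangent_space:
  "c \<in> A \<Longrightarrow> p \<in> fst c \<Longrightarrow> tvec_of A c p u \<in> tangent_space A p"
  by (auto simp: tvec_of_def tangent_space_def intro: transition_cocycle)

lemma tvec_of_components: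
  assumes "c \<in> A" "p \<in> fst c" "v \<in> tangent_space A p"
  shows "tvec_of A c p (v c) = v"
proof
  fix d
  show "tvec_of A c p (v c) d = v d"
  proof (cases "d \<in> A \<and> p \<in> fst d")
    case True
    then have "v d = frechet_derivative (snd d \<circ> chart_inv c) (at (snd c p)) (v c)"
      using assms unfolding tangent_space_def by blast
    then show ?thesis using True unfolding tvec_of_def by (simp only: simp_thms if_True)
  next
    case False
    then have "v d = 0" using assms(3) unfolding tangent_space_def by blast
    then show ?thesis using False unfolding tvec_of_def by (simp only: simp_thms if_False)
  qed
qed

lemma tvec_of_scaleR:
  assumes c: "c \<in> A" and p: "p \<in> fst c"
  shows "tvec_of A c p (r *\<^sub>R u) = (\<lambda>d. r *\<^sub>R tvec_of A c p u d)"
proof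
  fix d
  show "tvec_of A c p (r *\<^sub>R u) d = r *\<^sub>R tvec_of A c p u d"
  proof (cases "d \<in> A \<and> p \<in> fst d")
    case True
    then have "linear (frechet_derivative (snd d \<circ> chart_inv c) (at (snd c p)))"
      using transition_has_derivative[OF c, of d p] p has_derivative_linear by blast
    then show ?thesis using True by (simp add: tvec_of_def linear_cmul)
  qed (auto simp: tvec_of_def)
qed

lemma loc_eq:
  assumes "c \<in> A" "p \<in> fst c" "v \<in> tangent_space A p"
  shows "loc A c F (snd c p, v c) = F p v"
  using assms by (simp add: loc_def tvec_of_components)

lemma homogeneous_lagrangian_loc:
  assumes F: "pseudo_finsler A n F" and n: "n \<ge> 2" and c: "c \<in> A"
  shows "homogeneous_lagrangian (snd c ` fst c) n (loc A c F)"
proof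
  show "open (snd c ` fst c)" using c by (rule open_chart_image)
  show "smooth_on (loc A c F) (slit (snd c ` fst c))" using F c by (auto simp: pseudo_finsler_def)
  show "homogeneous_on n (snd c ` fst c) (loc A c F)"
    using F c unfolding homogeneous_on_def pseudo_finsler_def loc_def
    by (auto simp: tvec_of_scaleR tvec_of_in_tangent_space)
qed fact

lemma isotropic_TM_iff_isotropic_PTM:
  assumes F: "pseudo_finsler A n F" and c: "c \<in> A" "p \<in> fst c" and v: "v \<in> tangent_space A p"
    and k: "0 < v c $ k"
  shows "(p, v) \<in> isotropic_TM A F \<longleftrightarrow> ptm_coords c k p v \<in> isotropic_PTM A F c k"
proof -
  have "loc A c F (snd c p, (1 / v c $ k) *\<^sub>R v c) = F p (\<lambda>d. (1 / v c $ k) *\<^sub>R v d)"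
    using c v by (simp add: loc_def tvec_of_scaleR tvec_of_components)
  also have "\<dots> = (1 / v c $ k) powr n * F p v"
    using F v k unfolding pseudo_finsler_def by simp
  finally show ?thesis
    using v k c by (auto simp: isotropic_TM_def isotropic_PTM_def ptm_coords_def)
qed

section \<open>Euler--Lagrange solutions and isotropic lines\<close>

lemma open_curve_in_chart:
  assumes "regular_curve A I \<gamma>" "c \<in> A"
  shows "open (I \<inter> \<gamma> -` fst c)"
  using assms open_chart_domain
  by (intro continuous_open_preimage) (auto simp: regular_curve_def open_interval_def)

lemma regular_curve_derivatives:
  assumes "regular_curve A I \<gamma>" "c \<in> A" "t \<in> I" "\<gamma> t \<in> fst c"
  defines "x \<equiv> snd c \<circ> \<gamma>"
  defines "x' \<equiv> \<lambda>s. vector_derivative x (at s)"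
  shows "(x has_vector_derivative x' t) (at t)"
    and "(x' has_vector_derivative vector_derivative x' (at t)) (at t)"
    and "x' t \<noteq> 0"
proof -
  have "x differentiable (at t) \<and> x' differentiable (at t) \<and> x' t \<noteq> 0"
    using assms(1-4) unfolding regular_curve_def x'_def x_def by blast
  then show "(x has_vector_derivative x' t) (at t)"
    and "(x' has_vector_derivative vector_derivative x' (at t)) (at t)" and "x' t \<noteq> 0"
    unfolding x'_def by (auto simp flip: vector_derivative_works)
qed

lemma velocity_in_chart:
  "c \<in> A \<Longrightarrow> \<gamma> t \<in> fst c \<Longrightarrow> velocity A \<gamma> t c = vector_derivative (snd c \<circ> \<gamma>) (at t)"
  by (simp add: velocity_def)

lemma velocity_in_tangent_space:
  assumes \<gamma>: "regular_curve A I \<gamma>" and t: "t \<in> I"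
  shows "velocity A \<gamma> t \<in> tangent_space A (\<gamma> t)"
proof -
  have transform: "vector_derivative (snd d \<circ> \<gamma>) (at t)
      = frechet_derivative (snd d \<circ> chart_inv c) (at (snd c (\<gamma> t))) (vector_derivative (snd c \<circ> \<gamma>) (at t))"
    if c: "c \<in> A" "\<gamma> t \<in> fst c" and d: "d \<in> A" "\<gamma> t \<in> fst d" for c d
  proof (rule vector_derivative_at)
    have "((\<lambda>s. (snd d \<circ> chart_inv c) ((snd c \<circ> \<gamma>) s)) has_vector_derivative
        frechet_derivative (snd d \<circ> chart_inv c) (at (snd c (\<gamma> t))) (vector_derivative (snd c \<circ> \<gamma>) (at t))) (at t)"
    proof (rule has_vector_derivative_along_curve[OF regular_curve_derivatives(1)[OF \<gamma> c(1) t c(2)]])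
      show "((snd d \<circ> chart_inv c) has_derivative
          frechet_derivative (snd d \<circ> chart_inv c) (at (snd c (\<gamma> t)))) (at ((snd c \<circ> \<gamma>) t))"
        using transition_has_derivative[OF c(1) d(1), of "\<gamma> t"] c d by simp
    qed
    then show "((snd d \<circ> \<gamma>) has_vector_derivative
        frechet_derivative (snd d \<circ> chart_inv c) (at (snd c (\<gamma> t))) (vector_derivative (snd c \<circ> \<gamma>) (at t))) (at t)"
      by (rule has_vector_derivative_transform_within_open[OF _ open_curve_in_chart[OF \<gamma> c(1)]]) (use t c in auto)
  qed
  have "velocity A \<gamma> t d
      = frechet_derivative (snd d \<circ> chart_inv c) (at (snd c (\<gamma> t))) (velocity A \<gamma> t c)"
    if "c \<in> A" "d \<in> A" "\<gamma> t \<in> fst c \<inter> fst d" for c d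
    using transform[of c d] that by (simp add: velocity_in_chart)
  moreover have "velocity A \<gamma> t c = 0" if "c \<notin> A \<or> \<gamma> t \<notin> fst c" for c
    using that by (auto simp: velocity_def)
  ultimately show ?thesis unfolding tangent_space_def by blast
qed

text \<open>Near each instant the curve lies in one chart, where the derivative vanishes by
  \<open>energy_conservation\<close>; the quantity is defined without charts, so it is constant on the whole
  interval.\<close>

lemma EL_solution_energy_constant:
  assumes F: "pseudo_finsler A n F" "n \<ge> 2" and EL: "EL_solution A F I \<gamma>"
    and st: "s \<in> I" "t \<in> I"
  shows "F (\<gamma> s) (velocity A \<gamma> s) = F (\<gamma> t) (velocity A \<gamma> t)"
proof -
  have \<gamma>: "regular_curve A I \<gamma>" using EL by (simp add: EL_solution_def)
  have "((\<lambda>s. F (\<gamma> s) (velocity A \<gamma> s)) has_vector_derivative 0) (at r)" if r: "r \<in> I" for r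
  proof -
    obtain c where c: "c \<in> A" "\<gamma> r \<in> fst c" using chart_around by blast
    define x where "x = snd c \<circ> \<gamma>"
    define x' where "x' s = vector_derivative x (at s)" for s
    interpret homogeneous_lagrangian "snd c ` fst c" n "loc A c F"
      using homogeneous_lagrangian_loc F c by blast
    note deriv = regular_curve_derivatives[OF \<gamma> c(1) r c(2), folded x_def, folded x'_def]
    have slit: "(x r, x' r) \<in> slit (snd c ` fst c)" using c deriv(3) by (auto simp: x_def)
    have "((\<lambda>s. (x s, x' s)) has_vector_derivative (x' r, vector_derivative x' (at r))) (at r)"
      using deriv by (intro has_vector_derivative_Pair) auto
    then have "((\<lambda>s. loc A c F (x s, x' s)) has_vector_derivative
        frechet_derivative (loc A c F) (at (x r, x' r)) (x' r, vector_derivative x' (at r))) (at r)"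
      by (rule has_vector_derivative_along_curve) (use lagrangian_differentiable[OF slit] frechet_derivative_works in blast)
    moreover have "EL_equation (loc A c F) (x r) (x' r) (vector_derivative x' (at r))"
      using EL r c unfolding EL_solution_def x'_def[abs_def] x_def by simp
    ultimately have "((\<lambda>s. loc A c F (x s, x' s)) has_vector_derivative 0) (at r)"
      using energy_conservation[OF slit] by simp
    then show ?thesis
    proof (rule has_vector_derivative_transform_within_open[OF _ open_curve_in_chart[OF \<gamma> c(1)]])
      fix s assume s: "s \<in> I \<inter> \<gamma> -` fst c"
      then show "loc A c F (x s, x' s) = F (\<gamma> s) (velocity A \<gamma> s)"
        using loc_eq[OF c(1) _ velocity_in_tangent_space[OF \<gamma>], of s F] velocity_in_chart[OF c(1), of \<gamma> s]
        by (simp add: x_def x'_def)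
    qed (use r c in auto)
  qed
  then have "((\<lambda>s. F (\<gamma> s) (velocity A \<gamma> s)) has_vector_derivative 0) (at r within I)" if "r \<in> I" for r
    using that has_vector_derivative_at_within by blast
  moreover have "convex I"
    using \<gamma> by (simp add: regular_curve_def open_interval_def is_interval_convex)
  ultimately obtain e where "\<And>r. r \<in> I \<Longrightarrow> F (\<gamma> r) (velocity A \<gamma> r) = e"
    using has_vector_derivative_zero_constant[of I "\<lambda>s. F (\<gamma> s) (velocity A \<gamma> s)"] by blast
  then show ?thesis using st by simp
qed

lemma regular_curve_not_constant:
  assumes \<gamma>: "regular_curve A I \<gamma>"
  shows "\<not> \<gamma> constant_on I"
proof
  assume "\<gamma> constant_on I"
  then obtain p where p: "\<And>t. t \<in> I \<Longrightarrow> \<gamma> t = p" unfolding constant_on_def by blast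
  have I: "open I" "I \<noteq> {}" using \<gamma> by (auto simp: regular_curve_def open_interval_def)
  then obtain t where t: "t \<in> I" by blast
  obtain c where c: "c \<in> A" "\<gamma> t \<in> fst c" using chart_around by blast
  have "((snd c \<circ> \<gamma>) has_vector_derivative 0) (at t)"
    by (rule has_vector_derivative_transform_within_open[OF has_vector_derivative_const I(1) t, of "snd c p"])
       (simp add: p)
  then show False using regular_curve_derivatives(3)[OF \<gamma> c(1) t c(2)] vector_derivative_at by blast
qed

text \<open>The lift of the line to the projectivized tangent bundle is given by its own velocity.\<close>

lemma isotropic_line_nonparam_extremal:
  assumes F: "pseudo_finsler A n F" "n \<ge> 2" and dim: "CARD('m) = 2"
    and iso: "isotropic_line A F I \<gamma>"
  shows "nonparam_extremal A F I \<gamma>"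
proof -
  have \<gamma>: "regular_curve A I \<gamma>" and F0: "\<And>t. t \<in> I \<Longrightarrow> F (\<gamma> t) (velocity A \<gamma> t) = 0"
    using iso by (auto simp: isotropic_line_def)
  have "velocity A \<gamma> t \<noteq> (\<lambda>c. 0)" if t: "t \<in> I" for t
  proof -
    obtain c where c: "c \<in> A" "\<gamma> t \<in> fst c" using chart_around by blast
    then show ?thesis using regular_curve_derivatives(3)[OF \<gamma> c(1) t c(2)] velocity_in_chart[OF c(1), of \<gamma> t] c(2) by auto
  qed
  moreover have "\<exists>y' p'. ((\<lambda>s. ptm_coords c k (\<gamma> s) (velocity A \<gamma> s)) has_vector_derivative (y', p')) (at t) \<and>
      (y', p') \<noteq> (0, 0) \<and> (\<forall>i. y' $ i = snd z $ i * y' $ k) \<and>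
      (\<forall>i. cramer_H G z * p' $ i = (cramer_Hi i G z - snd z $ i * cramer_Hi k G z) * y' $ k)"
    if t: "t \<in> I" and c: "c \<in> A" "\<gamma> t \<in> fst c" and k: "0 < velocity A \<gamma> t c $ k"
      and G: "G = loc A c F" and z: "z = ptm_coords c k (\<gamma> t) (velocity A \<gamma> t)"
    for t c k G z
  proof -
    define x where "x = snd c \<circ> \<gamma>"
    define x' where "x' s = vector_derivative x (at s)" for s
    define p where "p s = (1 / x' s $ k) *\<^sub>R x' s" for s
    let ?J = "I \<inter> \<gamma> -` fst c"
    interpret homogeneous_lagrangian "snd c ` fst c" n G
      unfolding G using homogeneous_lagrangian_loc F c by blast
    have deriv: "(x has_vector_derivative x' s) (at s)"
        "(x' has_vector_derivative vector_derivative x' (at s)) (at s)" "x' s \<noteq> 0" if "s \<in> ?J" for s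
      using regular_curve_derivatives[OF \<gamma> c(1), of s, folded x_def, folded x'_def] that by auto
    have tJ: "t \<in> ?J" using t c by simp
    have vel: "velocity A \<gamma> s c = x' s" if "s \<in> ?J" for s
      using that velocity_in_chart[OF c(1), of \<gamma> s] by (simp add: x_def x'_def)
    have k': "0 < x' t $ k" using k vel[OF tJ] by simp
    have coords: "ptm_coords c k (\<gamma> s) (velocity A \<gamma> s) = (x s, p s)" if "s \<in> ?J" for s
      using vel[OF that] by (simp add: ptm_coords_def x_def p_def)
    have z': "z = (x t, p t)" using z coords[OF tJ] by simp
    have slit: "(x t, p t) \<in> slit (snd c ` fst c)"
      using c k' by (auto simp: x_def p_def)
    define x'' where "x'' = vector_derivative x' (at t)"
    \<comment> \<open>The quotient rule for \<open>p = x' / x'_k\<close>; its \<open>k\<close>-th entry is \<open>0\<close>, in accordance with \<open>p_k = 1\<close>.\<close>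
    define p' where "p' = (1 / x' t $ k) *\<^sub>R x'' - (x'' $ k / (x' t $ k)\<^sup>2) *\<^sub>R x' t"
    have dp: "(p has_vector_derivative p') (at t)"
    proof -
      have "((\<lambda>s. x' s $ k) has_real_derivative x'' $ k) (at t)"
        using has_vector_derivative_along_curve[OF deriv(2)[OF tJ], of "\<lambda>w. w $ k" "\<lambda>w. w $ k"]
        by (simp add: x''_def has_real_derivative_iff_has_vector_derivative
            bounded_linear_imp_has_derivative bounded_linear_vec_nth)
      then have "((\<lambda>s. 1 / x' s $ k) has_real_derivative - (x'' $ k / (x' t $ k)\<^sup>2)) (at t)"
        using k' by (auto intro!: derivative_eq_intros simp: power2_eq_square)
      from has_vector_derivative_scaleR[OF this deriv(2)[OF tJ]]
      show ?thesis by (simp add: p_def[abs_def] p'_def x''_def)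
    qed
    have dz: "((\<lambda>s. (x s, p s)) has_vector_derivative (x' t, p')) (at t)"
      using deriv(1)[OF tJ] dp by (rule has_vector_derivative_Pair)
    have "((\<lambda>s. G (x s, p s)) has_vector_derivative frechet_derivative G (at (x t, p t)) (x' t, p')) (at t)"
      using dz by (rule has_vector_derivative_along_curve) (use lagrangian_differentiable[OF slit] frechet_derivative_works in blast)
    moreover have "((\<lambda>s. G (x s, p s)) has_vector_derivative 0) (at t)"
    proof (rule has_vector_derivative_transform_within_open[OF has_vector_derivative_const])
      \<comment> \<open>Positive homogeneity transfers \<open>G = 0\<close> from \<open>x'\<close> to \<open>p\<close> only while \<open>x'_k > 0\<close>, an open condition.\<close>
      have "continuous_on ?J x'"
        using deriv(2) has_vector_derivative_continuous continuous_at_imp_continuous_on by blast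
      then show "open (?J \<inter> x' -` {w. 0 < w $ k})"
        by (rule continuous_open_preimage[OF _ open_curve_in_chart[OF \<gamma> c(1)] open_halfspace_component_gt_cart])
      show "t \<in> ?J \<inter> x' -` {w. 0 < w $ k}" using tJ k' by simp
      fix s assume s: "s \<in> ?J \<inter> x' -` {w. 0 < w $ k}"
      have "G (x s, x' s) = 0"
        using loc_eq[OF c(1) _ velocity_in_tangent_space[OF \<gamma>], of s F] vel[of s] F0[of s] s
        by (simp add: G x_def)
      then show "0 = G (x s, p s)"
        using homogeneous_onD[OF hom, of "x s" "x' s" "1 / x' s $ k"] s deriv(3)[of s]
        by (simp add: p_def x_def)
    qed
    ultimately have D0: "frechet_derivative G (at (x t, p t)) (x' t, p') = 0"
      by (rule vector_derivative_unique_at)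
    have G0: "G (x t, p t) = 0"
      using isotropic_TM_iff_isotropic_PTM[OF F(1) c velocity_in_tangent_space[OF \<gamma> t] k]
        F0[OF t] velocity_in_tangent_space[OF \<gamma> t] coords[OF tJ]
      by (simp add: isotropic_TM_def isotropic_PTM_def G)
    have pk: "p t $ k = 1" using k' by (simp add: p_def)
    have x'p: "x' t $ i = p t $ i * x' t $ k" for i using k' by (simp add: p_def)
    have p'k: "p' $ k = 0" using k' by (simp add: p'_def power2_eq_square)
    have "cramer_H G z * p' $ i = (cramer_Hi i G z - snd z $ i * cramer_Hi k G z) * x' t $ k" for i
      unfolding z' snd_conv by (rule two_dim_isotropic_velocity[OF dim slit G0 pk x'p p'k D0])
    moreover have "((\<lambda>s. ptm_coords c k (\<gamma> s) (velocity A \<gamma> s)) has_vector_derivative (x' t, p')) (at t)"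
      by (rule has_vector_derivative_transform_within_open[OF dz open_curve_in_chart[OF \<gamma> c(1)] tJ])
         (simp add: coords)
    moreover have "(x' t, p') \<noteq> (0, 0)" using deriv(3)[OF tJ] by simp
    moreover have "x' t $ i = snd z $ i * x' t $ k" for i unfolding z' snd_conv by (rule x'p)
    ultimately show ?thesis by blast
  qed
  ultimately have "proj_integral_curve A F I \<gamma> (velocity A \<gamma>)"
    using \<gamma> velocity_in_tangent_space[OF \<gamma>] unfolding proj_integral_curve_def Let_def regular_curve_def by blast
  then show ?thesis
    using regular_curve_not_constant[OF \<gamma>] by (auto simp: nonparam_extremal_def)
qed

end

section \<open>Invariance of the isotropic hypersurface\<close>

theorem lemma2:
  fixes A :: "('a::{t2_space, second_countable_topology}, 'm::finite) chart set"
    and F :: "'a \<Rightarrow> ('a, 'm) tvec \<Rightarrow> real"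
    and n :: real
  assumes "smooth_manifold A"
    and "CARD('m) \<ge> 2"
    and "n \<ge> 2"
    and "pseudo_finsler A n F"
  shows
    "(\<forall>p. \<forall>v\<in>tangent_space A p. \<forall>c\<in>A. \<forall>k. p \<in> fst c \<and> 0 < v c $ k \<longrightarrow>
        ((p, v) \<in> isotropic_TM A F \<longleftrightarrow> ptm_coords c k p v \<in> isotropic_PTM A F c k)) \<and>
     EL_invariant A F (isotropic_TM A F) \<and>
     (\<forall>c\<in>A. \<forall>k. field_tangent_to (proj_field k (loc A c F)) (isotropic_PTM A F c k)) \<and>
     (CARD('m) = 2 \<longrightarrow> (\<forall>I \<gamma>. isotropic_line A F I \<gamma> \<longrightarrow> nonparam_extremal A F I \<gamma>))"
proof -
  interpret manifold_atlas A using assms(1) by unfold_locales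
  have "EL_invariant A F (isotropic_TM A F)"
    unfolding EL_invariant_def
  proof (intro allI impI ballI)
    fix I \<gamma> t
    assume EL: "EL_solution A F I \<gamma>" and "\<exists>t\<in>I. (\<gamma> t, velocity A \<gamma> t) \<in> isotropic_TM A F" and t: "t \<in> I"
    then obtain s where "s \<in> I" "F (\<gamma> s) (velocity A \<gamma> s) = 0" by (auto simp: isotropic_TM_def)
    then have "F (\<gamma> t) (velocity A \<gamma> t) = 0"
      using EL_solution_energy_constant[OF assms(4,3) EL _ t] by metis
    moreover have "regular_curve A I \<gamma>" using EL by (simp add: EL_solution_def)
    ultimately show "(\<gamma> t, velocity A \<gamma> t) \<in> isotropic_TM A F"
      using velocity_in_tangent_space t by (auto simp: isotropic_TM_def)
  qed
  moreover have "field_tangent_to (proj_field k (loc A c F)) (isotropic_PTM A F c k)" if "c \<in> A" for c k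
    unfolding isotropic_PTM_def
    by (rule homogeneous_lagrangian.proj_field_tangent[OF homogeneous_lagrangian_loc[OF assms(4,3) that]])
  ultimately show ?thesis
    using isotropic_TM_iff_isotropic_PTM[OF assms(4)]
      isotropic_line_nonparam_extremal[OF assms(4,3)] by blast
qed

end
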